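(* Let $G$ be an $\widetilde{\mathfrak M}_c$-group and $H$ an almost solvable subgroup of $G$ of class $n$. Then there exists a definable solvable subgroup $D$ of $G$ of class at most $2n$ such that $H\cap D$ has finite index in $H$.
   Context: $G$ is a group, possibly with additional first-order structure ("definable" = definable with parameters). $G$ is an $\widetilde{\mathfrak M}_c$-group if for any two definable subgroups $K,N$ of $G$ with $N$ normalized by $K$ there are natural numbers $n_0,d$ such that every chain of centralizers $C_{K/N}(g_0N)\geq C_{K/N}(g_0N,g_1N)\geq\cdots$ ($g_i\in K$, centralizers in $K/(K\cap N)$) with each group of index at least $d$ in its predecessor has length at most $n_0$. A group is almost abelian if the centralizer of each of its elements has finite index in it. A group $H$ is almost solvable if there is a finite sequence of normal subgroups $H=H_0\trianglerighteq H_1\trianglerighteq\cdots\trianglerighteq H_n=\{1\}$ of $H$ with each $H_i/H_{i+1}$ almost abelian; the least such $n$ is the almost solvable class. *)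

theory Defs
  imports "HOL-Algebra.Algebra"
begin

section \<open>Groups with additional first-order structure\<close>

text \<open>
  The group operations belong to every language. The additional symbols are given with
  their arities, as pairs in \<open>funs\<close> and \<open>rels\<close>; a pure group has both sets empty. The values of
  an interpretation at a symbol outside these sets, or at a list of the wrong length or leaving
  the carrier, play no role.
\<close>

record ('a, 'f, 'r) group_structure = "'a monoid" +
  funs :: "('f \<times> nat) set"
  rels :: "('r \<times> nat) set"
  fun_interp :: "'f \<Rightarrow> 'a list \<Rightarrow> 'a"
  rel_interp :: "'r \<Rightarrow> 'a list \<Rightarrow> bool"

locale fo_group = group G for G :: "('a, 'f, 'r) group_structure" (structure) +
  assumes fun_interp_closed:
    "\<lbrakk>(f, length xs) \<in> funs G; set xs \<subseteq> carrier G\<rbrakk> \<Longrightarrow> fun_interp G f xs \<in> carrier G"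

datatype 'f fo_term =
    TVar nat
  | TOne
  | TMult "'f fo_term" "'f fo_term"
  | TInv "'f fo_term"
  | TFun 'f "'f fo_term list"

datatype ('f, 'r) fo_formula =
    FEq "'f fo_term" "'f fo_term"
  | FRel 'r "'f fo_term list"
  | FNot "('f, 'r) fo_formula"
  | FAnd "('f, 'r) fo_formula" "('f, 'r) fo_formula"
  | FEx nat "('f, 'r) fo_formula"

primrec wf_term :: "('f \<times> nat) set \<Rightarrow> 'f fo_term \<Rightarrow> bool" where
  "wf_term F (TVar v) = True"
| "wf_term F TOne = True"
| "wf_term F (TMult s t) = (wf_term F s \<and> wf_term F t)"
| "wf_term F (TInv t) = wf_term F t"
| "wf_term F (TFun f ts) = ((f, length ts) \<in> F \<and> list_all (wf_term F) ts)"

primrec wf_formula :: "('f \<times> nat) set \<Rightarrow> ('r \<times> nat) set \<Rightarrow> ('f, 'r) fo_formula \<Rightarrow> bool" where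
  "wf_formula F R (FEq s t) = (wf_term F s \<and> wf_term F t)"
| "wf_formula F R (FRel r ts) = ((r, length ts) \<in> R \<and> list_all (wf_term F) ts)"
| "wf_formula F R (FNot p) = wf_formula F R p"
| "wf_formula F R (FAnd p q) = (wf_formula F R p \<and> wf_formula F R q)"
| "wf_formula F R (FEx v p) = wf_formula F R p"

primrec term_val :: "('a, 'f, 'r) group_structure \<Rightarrow> (nat \<Rightarrow> 'a) \<Rightarrow> 'f fo_term \<Rightarrow> 'a" where
  "term_val G e (TVar v) = e v"
| "term_val G e TOne = \<one>\<^bsub>G\<^esub>"
| "term_val G e (TMult s t) = term_val G e s \<otimes>\<^bsub>G\<^esub> term_val G e t"
| "term_val G e (TInv t) = inv\<^bsub>G\<^esub> (term_val G e t)"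
| "term_val G e (TFun f ts) = fun_interp G f (map (term_val G e) ts)"

primrec satisfies :: "('a, 'f, 'r) group_structure \<Rightarrow> (nat \<Rightarrow> 'a) \<Rightarrow> ('f, 'r) fo_formula \<Rightarrow> bool" where
  "satisfies G e (FEq s t) = (term_val G e s = term_val G e t)"
| "satisfies G e (FRel r ts) = rel_interp G r (map (term_val G e) ts)"
| "satisfies G e (FNot p) = (\<not> satisfies G e p)"
| "satisfies G e (FAnd p q) = (satisfies G e p \<and> satisfies G e q)"
| "satisfies G e (FEx v p) = (\<exists>a\<in>carrier G. satisfies G (e(v := a)) p)"

text \<open>
  Variable 0 is the free variable of the defining formula; the values of \<open>e\<close> at the other
  variables are the parameters, of which only finitely many occur in a given formula.
\<close>

definition definable :: "('a, 'f, 'r) group_structure \<Rightarrow> 'a set \<Rightarrow> bool" where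
  "definable G A \<longleftrightarrow>
     (\<exists>p e. wf_formula (funs G) (rels G) p \<and> (\<forall>v. e v \<in> carrier G) \<and>
        A = {x \<in> carrier G. satisfies G (e(0 := x)) p})"

section \<open>Centralizers and the chain condition\<close>

definition centralizer :: "('a, 'b) monoid_scheme \<Rightarrow> 'a set \<Rightarrow> 'a set" where
  "centralizer G S = {x \<in> carrier G. \<forall>y\<in>S. x \<otimes>\<^bsub>G\<^esub> y = y \<otimes>\<^bsub>G\<^esub> x}"

definition finite_index :: "('a, 'b) monoid_scheme \<Rightarrow> 'a set \<Rightarrow> bool" where
  "finite_index G H \<longleftrightarrow> finite (rcosets\<^bsub>G\<^esub> H)"

text \<open>An infinite index is at least every \<open>d\<close>, whereas \<open>card\<close> would give 0.\<close>

definition index_at_least :: "('a, 'b) monoid_scheme \<Rightarrow> 'a set \<Rightarrow> nat \<Rightarrow> bool" where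
  "index_at_least G H d \<longleftrightarrow> \<not> finite_index G H \<or> d \<le> card (rcosets\<^bsub>G\<^esub> H)"

text \<open>
  For \<open>gs = [g\<^sub>0, \<dots>, g\<^sub>m]\<close>, this is the centralizer in \<open>K/(K \<inter> N)\<close> of the cosets of
  \<open>g\<^sub>0, \<dots>, g\<^sub>m\<close>.
\<close>

definition quot_centralizer ::
    "('a, 'b) monoid_scheme \<Rightarrow> 'a set \<Rightarrow> 'a set \<Rightarrow> 'a list \<Rightarrow> 'a set set" where
  "quot_centralizer G K N gs =
     centralizer ((G\<lparr>carrier := K\<rparr>) Mod (K \<inter> N)) ((\<lambda>g. (K \<inter> N) #>\<^bsub>G\<^esub> g) ` set gs)"

text \<open>
  The length of a chain is its number of centralizers. Bounding finite chains also
  excludes infinite ones, whose initial segments would be arbitrarily long.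
\<close>

definition Mc_tilde :: "('a, 'f, 'r) group_structure \<Rightarrow> bool" where
  "Mc_tilde G \<longleftrightarrow>
     (\<forall>K N. subgroup K G \<and> definable G K \<and> subgroup N G \<and> definable G N \<and>
        K \<subseteq> normalizer G N \<longrightarrow>
        (\<exists>n\<^sub>0 d. \<forall>gs. set gs \<subseteq> K \<and>
           (\<forall>i. Suc i < length gs \<longrightarrow>
              index_at_least
                (((G\<lparr>carrier := K\<rparr>) Mod (K \<inter> N))
                   \<lparr>carrier := quot_centralizer G K N (take (Suc i) gs)\<rparr>)
                (quot_centralizer G K N (take (Suc (Suc i)) gs)) d)
           \<longrightarrow> length gs \<le> n\<^sub>0))"

section \<open>Almost solvable groups\<close>

definition almost_abelian :: "('a, 'b) monoid_scheme \<Rightarrow> bool" where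
  "almost_abelian G \<longleftrightarrow> (\<forall>x\<in>carrier G. finite_index G (centralizer G {x}))"

definition almost_solvable_series ::
    "('a, 'b) monoid_scheme \<Rightarrow> nat \<Rightarrow> (nat \<Rightarrow> 'a set) \<Rightarrow> bool" where
  "almost_solvable_series H n S \<longleftrightarrow>
     S 0 = carrier H \<and> S n = {\<one>\<^bsub>H\<^esub>} \<and>
     (\<forall>i\<le>n. S i \<lhd> H) \<and>
     (\<forall>i<n. S (Suc i) \<subseteq> S i \<and> almost_abelian ((H\<lparr>carrier := S i\<rparr>) Mod S (Suc i)))"

definition almost_solvable :: "('a, 'b) monoid_scheme \<Rightarrow> bool" where
  "almost_solvable H \<longleftrightarrow> (\<exists>n S. almost_solvable_series H n S)"

definition almost_solvable_class :: "('a, 'b) monoid_scheme \<Rightarrow> nat" where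
  "almost_solvable_class H = (LEAST n. \<exists>S. almost_solvable_series H n S)"

text \<open>The class of a solvable group is its derived length.\<close>

definition solvable_class :: "('a, 'b) monoid_scheme \<Rightarrow> nat" where
  "solvable_class G = (LEAST n. (derived G ^^ n) (carrier G) = {\<one>\<^bsub>G\<^esub>})"

end

theory Submission
  imports Defs
begin

text \<open>
  Write \<open>X \<lesssim> Y\<close> if finitely many cosets of \<open>Y\<close> cover \<open>X\<close>. The group \<open>D\<close> is built from the bottom of
  the series upwards: given a definable solvable \<open>N\<close> normalized by \<open>H\<close> with \<open>H\<^sub>i\<^sub>+\<^sub>1 \<lesssim> N\<close>, one works in
  the quotient of the normalizer of \<open>N\<close> by \<open>N\<close>, where the image \<open>A\<close> of \<open>H\<^sub>i\<close> is almost abelian.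

  By the chain condition some centralizer \<open>E\<close> of finitely many elements of \<open>A\<close> satisfies
  \<open>E \<lesssim> C(a)\<close> for all \<open>a \<in> A\<close>, with a uniform bound, and \<open>A \<lesssim> E\<close>. The group
  \<open>F = {x. E \<lesssim> C(x)}\<close> contains \<open>A\<close> and does not change when \<open>E\<close> is conjugated by an element of \<open>H\<close>; again
  by the chain condition the index is bounded on \<open>F\<close>, so \<open>F\<close> is definable. B. H. Neumann's covering
  lemma makes almost centralization symmetric, whence \<open>A \<lesssim> E \<lesssim> {x. F \<lesssim> C(x)}\<close>, and \<open>A\<close> is almost
  contained in the definable group \<open>F' = {x \<in> F. F \<lesssim> C(x)}\<close>, whose conjugacy classes are uniformly
  finite. Such a group has only finitely many commutators, so the elements of \<open>F'\<close> centralizing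
  all its commutators form a definable subgroup of finite index which is nilpotent of class
  at most 2. Its preimage is the next group, with derived length increased by at most 2.
\<close>

section \<open>Almost containment\<close>

text \<open>At most \<open>m\<close> right cosets of \<open>B\<close> cover \<open>A\<close>. The
  representatives come from the whole group, so the relation makes sense for arbitrary sets and
  composes well. The number \<open>m\<close> is kept explicit because a formula can express only a
  bounded index.\<close>

definition index_le :: "('a, 'b) monoid_scheme \<Rightarrow> 'a set \<Rightarrow> 'a set \<Rightarrow> nat \<Rightarrow> bool" where
  "index_le G A B m \<longleftrightarrow>
     (\<exists>T. T \<subseteq> carrier G \<and> finite T \<and> card T \<le> m \<and> (\<forall>x\<in>A. \<exists>t\<in>T. x \<otimes>\<^bsub>G\<^esub> inv\<^bsub>G\<^esub> t \<in> B))"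

definition almost_contained :: "('a, 'b) monoid_scheme \<Rightarrow> 'a set \<Rightarrow> 'a set \<Rightarrow> bool" where
  "almost_contained G A B \<longleftrightarrow> (\<exists>m. index_le G A B m)"

text \<open>For a subgroup \<open>A\<close> these are the elements with finitely many conjugates
  under \<open>A\<close>; for the whole group this is the FC-centre.\<close>

definition almost_centralizer :: "('a, 'b) monoid_scheme \<Rightarrow> 'a set \<Rightarrow> 'a set" where
  "almost_centralizer G A = {x \<in> carrier G. almost_contained G A (centralizer G {x})}"

lemma index_le_mono:
  assumes "index_le G A B m" "A' \<subseteq> A" "B \<subseteq> B'" "m \<le> m'"
  shows "index_le G A' B' m'"
proof -
  obtain T where T: "T \<subseteq> carrier G" "finite T" "card T \<le> m"
    "\<forall>x\<in>A. \<exists>t\<in>T. x \<otimes>\<^bsub>G\<^esub> inv\<^bsub>G\<^esub> t \<in> B"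
    using assms(1) unfolding index_le_def by auto
  have "\<forall>x\<in>A'. \<exists>t\<in>T. x \<otimes>\<^bsub>G\<^esub> inv\<^bsub>G\<^esub> t \<in> B'" using T(4) assms(2,3) by blast
  then show ?thesis unfolding index_le_def using T assms(4) by (intro exI[of _ T]) auto
qed

lemma almost_contained_mono:
  assumes "almost_contained G A B" "A' \<subseteq> A" "B \<subseteq> B'"
  shows "almost_contained G A' B'"
  using assms index_le_mono unfolding almost_contained_def by (metis le_refl)

lemma almost_containedI:
  assumes "T \<subseteq> carrier G" "finite T" "\<And>x. x \<in> A \<Longrightarrow> \<exists>t\<in>T. x \<otimes>\<^bsub>G\<^esub> inv\<^bsub>G\<^esub> t \<in> B"
  shows "almost_contained G A B"
  unfolding almost_contained_def index_le_def using assms by blast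

lemma almost_containedE:
  assumes "almost_contained G A B"
  obtains T where "T \<subseteq> carrier G" "finite T" "\<And>x. x \<in> A \<Longrightarrow> \<exists>t\<in>T. x \<otimes>\<^bsub>G\<^esub> inv\<^bsub>G\<^esub> t \<in> B"
  using assms unfolding almost_contained_def index_le_def by blast

lemma centralizer_insert:
  "centralizer G (insert x S) = centralizer G {x} \<inter> centralizer G S"
  unfolding centralizer_def by auto

context group
begin

text \<open>Together with \<open>m_assoc\<close> and \<open>inv_mult_group\<close> these rules
  reduce words in the group, so that \<open>simp\<close> can settle the commutator identities used
  later.\<close>

lemma mult_inv_cancel [simp]:
  assumes "x \<in> carrier G" "y \<in> carrier G"
  shows "x \<otimes> (inv x \<otimes> y) = y" "inv x \<otimes> (x \<otimes> y) = y"
  using assms by (simp_all add: m_assoc[symmetric])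

lemma mult_inv_eq_conv:
  assumes "x \<in> carrier G" "y \<in> carrier G" "z \<in> carrier G"
  shows "x \<otimes> inv y = z \<longleftrightarrow> x = z \<otimes> y"
  using assms by (auto simp: m_assoc)

lemma subgroup_centralizer: "S \<subseteq> carrier G \<Longrightarrow> subgroup (centralizer G S) G"
proof (rule subgroupI)
  assume S: "S \<subseteq> carrier G"
  show "centralizer G S \<subseteq> carrier G" by (auto simp: centralizer_def)
  have "\<one> \<in> centralizer G S" using S by (auto simp: centralizer_def)
  then show "centralizer G S \<noteq> {}" by blast
  fix a b assume a: "a \<in> centralizer G S"
  show "inv a \<in> centralizer G S"
    unfolding centralizer_def
  proof (intro CollectI conjI ballI)
    show ac: "inv a \<in> carrier G" using a by (auto simp: centralizer_def)
    fix y assume "y \<in> S"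
    then have y: "y \<in> carrier G" "a \<otimes> y = y \<otimes> a" "a \<in> carrier G"
      using S a by (auto simp: centralizer_def)
    then have "y = inv a \<otimes> (y \<otimes> a)" by (simp flip: y(2))
    then show "inv a \<otimes> y = y \<otimes> inv a"
      using y by (metis inv_closed inv_solve_right m_assoc m_closed)
  qed
  assume b: "b \<in> centralizer G S"
  show "a \<otimes> b \<in> centralizer G S"
    unfolding centralizer_def
  proof (intro CollectI conjI ballI)
    show "a \<otimes> b \<in> carrier G" using a b by (auto simp: centralizer_def)
    fix y assume "y \<in> S"
    then have y: "y \<in> carrier G" "a \<otimes> y = y \<otimes> a" "a \<in> carrier G" "b \<otimes> y = y \<otimes> b" "b \<in> carrier G"
      using S a b by (auto simp: centralizer_def)
    then show "a \<otimes> b \<otimes> y = y \<otimes> (a \<otimes> b)" by (metis m_assoc)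
  qed
qed

lemma index_le_self: "subgroup B G \<Longrightarrow> A \<subseteq> B \<Longrightarrow> index_le G A B 1"
  unfolding index_le_def
  by (rule exI[of _ "{\<one>}"]) (use subgroup.mem_carrier in fastforce)

lemma almost_contained_subset: "subgroup B G \<Longrightarrow> A \<subseteq> B \<Longrightarrow> almost_contained G A B"
  using index_le_self unfolding almost_contained_def by blast

text \<open>If \<open>x \<otimes> inv t \<in> B\<close> and
  \<open>x \<otimes> inv t \<otimes> inv s \<in> Z\<close>, then \<open>x\<close> lies in the coset
  of \<open>s \<otimes> t\<close> modulo \<open>Z\<close>; so the products of representatives, in
  this order, represent the cosets of \<open>Z\<close>.\<close>

lemma index_le_trans:
  assumes "index_le G A B m" "index_le G B Z k" "A \<subseteq> carrier G"
  shows "index_le G A Z (m * k)"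
proof -
  obtain T where T: "T \<subseteq> carrier G" "finite T" "card T \<le> m" "\<And>x. x \<in> A \<Longrightarrow> \<exists>t\<in>T. x \<otimes> inv t \<in> B"
    using assms(1) unfolding index_le_def by auto
  obtain S where S: "S \<subseteq> carrier G" "finite S" "card S \<le> k" "\<And>x. x \<in> B \<Longrightarrow> \<exists>t\<in>S. x \<otimes> inv t \<in> Z"
    using assms(2) unfolding index_le_def by auto
  let ?U = "(\<lambda>(t, s). s \<otimes> t) ` (T \<times> S)"
  have "card ?U \<le> card (T \<times> S)" using T S by (intro card_image_le) auto
  also have "\<dots> \<le> m * k" using T S by (simp add: card_cartesian_product mult_le_mono)
  finally have "card ?U \<le> m * k" .
  moreover have "\<exists>u\<in>?U. x \<otimes> inv u \<in> Z" if x: "x \<in> A" for x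
  proof -
    obtain t where t: "t \<in> T" "x \<otimes> inv t \<in> B" using T(4) x by blast
    then obtain s where s: "s \<in> S" "x \<otimes> inv t \<otimes> inv s \<in> Z" using S(4) by blast
    have "x \<otimes> inv t \<otimes> inv s = x \<otimes> inv (s \<otimes> t)"
      using t s T(1) S(1) x assms(3) by (simp add: inv_mult_group m_assoc subset_iff)
    then show ?thesis using t s by force
  qed
  ultimately show ?thesis
    unfolding index_le_def using T S by (intro exI[of _ ?U]) auto
qed

lemma almost_contained_trans:
  assumes "almost_contained G A B" "almost_contained G B Z" "A \<subseteq> carrier G"
  shows "almost_contained G A Z"
  using assms index_le_trans unfolding almost_contained_def by blast

text \<open>If a coset of \<open>B\<close> meets a coset of \<open>Z\<close>, the intersection is a
  single coset of \<open>B \<inter> Z\<close>. Hence it suffices to count pairs of cosets.\<close>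

lemma index_le_Int:
  assumes "index_le G A B m" "index_le G A Z k" "A \<subseteq> carrier G" "subgroup B G" "subgroup Z G"
  shows "index_le G A (B \<inter> Z) (m * k)"
proof -
  obtain T where T: "T \<subseteq> carrier G" "finite T" "card T \<le> m" "\<And>x. x \<in> A \<Longrightarrow> \<exists>t\<in>T. x \<otimes> inv t \<in> B"
    using assms(1) unfolding index_le_def by auto
  obtain S where S: "S \<subseteq> carrier G" "finite S" "card S \<le> k" "\<And>x. x \<in> A \<Longrightarrow> \<exists>t\<in>S. x \<otimes> inv t \<in> Z"
    using assms(2) unfolding index_le_def by auto
  define P where "P = (\<lambda>t s u. u \<in> A \<and> u \<otimes> inv t \<in> B \<and> u \<otimes> inv s \<in> Z)"
  \<comment> \<open>For each pair of cosets with a common point in \<open>A\<close>,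
    \<open>f\<close> picks such a point; the default \<open>\<one>\<close> keeps the image in the
    carrier.\<close>
  define f where "f = (\<lambda>(t, s). if \<exists>u. P t s u then SOME u. P t s u else \<one>)"
  have P: "P t s (f (t, s))" if "P t s u" for t s u
    unfolding f_def using that someI[of "P t s" u] by auto
  let ?U = "f ` (T \<times> S)"
  have "card ?U \<le> card (T \<times> S)" using T S by (intro card_image_le) auto
  also have "\<dots> \<le> m * k" using T S by (simp add: card_cartesian_product mult_le_mono)
  finally have "card ?U \<le> m * k" .
  moreover have "?U \<subseteq> carrier G"
  proof clarify
    fix t s show "f (t, s) \<in> carrier G"
      using P[of t s] assms(3) unfolding f_def P_def
      by (cases "\<exists>u. P t s u") (auto simp: f_def P_def)
  qed
  moreover have "\<exists>u\<in>?U. x \<otimes> inv u \<in> B \<inter> Z" if x: "x \<in> A" for x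
  proof -
    obtain t where t: "t \<in> T" "x \<otimes> inv t \<in> B" using T(4) x by blast
    obtain s where s: "s \<in> S" "x \<otimes> inv s \<in> Z" using S(4) x by blast
    define u where "u = f (t, s)"
    have u: "u \<in> A" "u \<otimes> inv t \<in> B" "u \<otimes> inv s \<in> Z"
      using P[of t s x] t s x unfolding P_def u_def by auto
    have c: "x \<in> carrier G" "u \<in> carrier G" "t \<in> carrier G" "s \<in> carrier G"
      using assms(3) x u t s T S by auto
    have "(x \<otimes> inv t) \<otimes> inv (u \<otimes> inv t) \<in> B"
      using t u assms(4) by (simp add: subgroup_def)
    moreover have "(x \<otimes> inv s) \<otimes> inv (u \<otimes> inv s) \<in> Z"
      using s u assms(5) by (simp add: subgroup_def)
    ultimately have "x \<otimes> inv u \<in> B \<inter> Z"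
      using c by (simp add: inv_mult_group m_assoc)
    then show ?thesis using t s u_def by blast
  qed
  ultimately show ?thesis
    unfolding index_le_def using T S by (intro exI[of _ ?U]) auto
qed

lemma almost_contained_Int:
  assumes "almost_contained G A B" "almost_contained G A Z" "A \<subseteq> carrier G" "subgroup B G" "subgroup Z G"
  shows "almost_contained G A (B \<inter> Z)"
  using assms index_le_Int unfolding almost_contained_def by blast

text \<open>The centralizer of a finite set is a finite intersection of centralizers of elements,
  and finite intersections preserve almost containment.\<close>

lemma almost_contained_centralizer_finite:
  assumes "finite S" "S \<subseteq> carrier G" "A \<subseteq> carrier G"
    "\<And>s. s \<in> S \<Longrightarrow> almost_contained G A (centralizer G {s})"
  shows "almost_contained G A (centralizer G S)"
  using assms
proof (induction S rule: finite_induct)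
  case empty
  have "centralizer G {} = carrier G" by (auto simp: centralizer_def)
  then show ?case using almost_contained_subset[OF subgroup_self] assms(3) by simp
next
  case (insert s S)
  then show ?case
    unfolding centralizer_insert[of G s S]
    by (intro almost_contained_Int subgroup_centralizer) auto
qed

lemma subgroup_mult_invD:
  assumes "subgroup B G" "x \<otimes> inv t \<in> B" "y \<otimes> inv t \<in> B" "x \<in> carrier G" "y \<in> carrier G" "t \<in> carrier G"
  shows "x \<otimes> inv y \<in> B"
proof -
  have "(x \<otimes> inv t) \<otimes> inv (y \<otimes> inv t) \<in> B" using assms(1-3) by (simp add: subgroup_def)
  then show ?thesis using assms(4-6) by (simp add: inv_mult_group m_assoc)
qed

section \<open>Counting distinct cosets and Neumann's covering lemma\<close>

lemma index_le_pigeonhole: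
  assumes "index_le G A B m" "subgroup B G" "U \<subseteq> A" "A \<subseteq> carrier G" "m < card U"
  obtains u v where "u \<in> U" "v \<in> U" "u \<noteq> v" "u \<otimes> inv v \<in> B"
proof -
  obtain T where T: "T \<subseteq> carrier G" "finite T" "card T \<le> m" "\<And>x. x \<in> A \<Longrightarrow> \<exists>t\<in>T. x \<otimes> inv t \<in> B"
    using assms(1) unfolding index_le_def by auto
  obtain f where f: "\<And>x. x \<in> U \<Longrightarrow> f x \<in> T \<and> x \<otimes> inv (f x) \<in> B"
    using T(4) assms(3) by (metis subsetD)
  have "f ` U \<subseteq> T" using f by auto
  then have "card (f ` U) \<le> m" using T card_mono le_trans by blast
  then have "\<not> inj_on f U" using pigeonhole assms(5) by (metis le_less_trans)
  then obtain u v where uv: "u \<in> U" "v \<in> U" "u \<noteq> v" "f u = f v" by (auto simp: inj_on_def)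
  then have "u \<otimes> inv v \<in> B"
    using f[of u] f[of v] assms(2-4) T(1) by (intro subgroup_mult_invD[of B u "f u" v]) auto
  then show ?thesis using uv that by blast
qed

text \<open>A set whose elements lie in pairwise different cosets can be enlarged as long as it has
  at most \<open>m\<close> elements: otherwise it would itself be a set of representatives for the
  cover.\<close>

lemma not_index_leE:
  assumes "\<not> index_le G A B m" "subgroup B G" "A \<subseteq> carrier G"
  obtains U where "U \<subseteq> A" "finite U" "card U = Suc m"
    "\<And>u v. u \<in> U \<Longrightarrow> v \<in> U \<Longrightarrow> u \<noteq> v \<Longrightarrow> u \<otimes> inv v \<notin> B"
proof -
  have "\<exists>U \<subseteq> A. finite U \<and> card U = k \<and> (\<forall>u\<in>U. \<forall>v\<in>U. u \<noteq> v \<longrightarrow> u \<otimes> inv v \<notin> B)"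
    if "k \<le> Suc m" for k
    using that
  proof (induction k)
    case 0
    show ?case by (rule exI[of _ "{}"]) auto
  next
    case (Suc k)
    then obtain U where U: "U \<subseteq> A" "finite U" "card U = k" "\<forall>u\<in>U. \<forall>v\<in>U. u \<noteq> v \<longrightarrow> u \<otimes> inv v \<notin> B"
      by auto
    then have "\<not> (\<forall>x\<in>A. \<exists>u\<in>U. x \<otimes> inv u \<in> B)"
      using assms(1,3) Suc.prems unfolding index_le_def by (meson Suc_le_mono subset_trans)
    then obtain x where x: "x \<in> A" "\<And>u. u \<in> U \<Longrightarrow> x \<otimes> inv u \<notin> B"
      by blast
    have c: "x \<in> carrier G" "U \<subseteq> carrier G" using x U assms(3) by auto
    have n: "u \<otimes> inv x \<notin> B" if u: "u \<in> U" for u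
    proof
      assume "u \<otimes> inv x \<in> B"
      then have "inv (u \<otimes> inv x) \<in> B" using assms(2) by (simp add: subgroup_def)
      then show False using x(2)[OF u] c u by (auto simp: inv_mult_group subset_iff)
    qed
    have "x \<notin> U" using x(2) c subgroup.one_closed[OF assms(2)] by (metis r_inv)
    then show ?case using U x n by (intro exI[of _ "insert x U"]) auto
  qed
  then show ?thesis using that by (metis le_refl)
qed

text \<open>B. H. Neumann's lemma: a group covered by finitely many cosets is already covered, up to
  finite index, by one of the subgroups involved. The induction eliminates one subgroup from
  the cover by hiding its cosets inside translates of the other ones.\<close>

lemma almost_contained_of_finite_cover:
  assumes "finite P" "subgroup K G" "\<And>C t. (C, t) \<in> P \<Longrightarrow> subgroup C G \<and> t \<in> carrier G"
    "\<And>x. x \<in> K \<Longrightarrow> \<exists>(C, t) \<in> P. x \<otimes> inv t \<in> C"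
  shows "\<exists>C\<in>fst ` P. almost_contained G K C"
  using assms
\<comment> \<open>The induction counts distinct subgroups, not cosets: a step may increase the
  number of cosets while one subgroup disappears.\<close>
proof (induction "card (fst ` P)" arbitrary: P rule: less_induct)
  case less
  have K: "K \<subseteq> carrier G" "\<one> \<in> K" using less.prems(2) by (auto simp: subgroup_def)
  obtain C t0 where C0: "(C, t0) \<in> P" using less.prems(4)[OF K(2)] by auto
  have C: "subgroup C G" using less.prems(3)[OF C0] by simp
  let ?T = "{t. (C, t) \<in> P}"
  have "?T \<subseteq> snd ` P" by force
  then have T: "finite ?T" "?T \<subseteq> carrier G"
    using finite_subset less.prems(1,3) by blast+
  show ?case
  proof (cases "\<forall>x\<in>K. \<exists>t\<in>?T. x \<otimes> inv t \<in> C")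
    case True
    then have "almost_contained G K C" using almost_containedI[OF T(2,1)] by blast
    then show ?thesis using C0 by force
  next
    case False
    then obtain x where x: "x \<in> K" "\<And>t. t \<in> ?T \<Longrightarrow> x \<otimes> inv t \<notin> C" by blast
    have xc: "x \<in> carrier G" using x K by auto
    define R where "R = {(C', t) \<in> P. C' \<noteq> C}"
    have R: "finite R" "R \<subseteq> P" unfolding R_def using less.prems(1) by (auto intro: finite_subset)
    \<comment> \<open>\<open>s t\<close> replaces \<open>t\<close> by a representative of the same
      coset inside \<open>K\<close>, so that \<open>y \<otimes> inv (s t)\<close> stays in
      \<open>K\<close>; if the coset misses \<open>K\<close>, the default \<open>\<one>\<close>
      still lies in \<open>K\<close>.\<close>
    define s where "s = (\<lambda>t. if \<exists>u\<in>K. u \<otimes> inv t \<in> C then SOME u. u \<in> K \<and> u \<otimes> inv t \<in> C else \<one>)"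
    have s: "s t \<in> K \<and> s t \<otimes> inv t \<in> C" if "u \<in> K" "u \<otimes> inv t \<in> C" for u t
      using someI[of "\<lambda>u. u \<in> K \<and> u \<otimes> inv t \<in> C" u] that unfolding s_def by auto
    have sK: "s t \<in> K" for t
      using s[of _ t] K(2) unfolding s_def by (cases "\<exists>u\<in>K. u \<otimes> inv t \<in> C") (auto simp: s_def)
    \<comment> \<open>An element \<open>y\<close> of \<open>K\<close> in the coset of
      \<open>t\<close> modulo \<open>C\<close> is \<open>z \<otimes> s t\<close> with
      \<open>z\<close> in both \<open>C\<close> and \<open>K\<close>. Then
      \<open>z \<otimes> x\<close> lies in the coset of \<open>x\<close>, which avoids every coset
      of \<open>C\<close> in the cover, so it is covered by a coset of another subgroup. Translating
      that coset by \<open>inv x \<otimes> s t\<close> covers \<open>y\<close> without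
      \<open>C\<close>.\<close>
    define P' where "P' = R \<union> (\<lambda>((C', t'), t). (C', t' \<otimes> inv x \<otimes> s t)) ` (R \<times> ?T)"
    have fst: "fst ` P' \<subseteq> fst ` P - {C}" unfolding P'_def R_def by force
    have "C \<in> fst ` P" using C0 by force
    then have "card (fst ` P - {C}) < card (fst ` P)" using less.prems(1) by (intro card_Diff1_less) simp_all
    moreover have "card (fst ` P') \<le> card (fst ` P - {C})"
      using fst less.prems(1) by (intro card_mono) simp_all
    ultimately have lt: "card (fst ` P') < card (fst ` P)" by linarith
    have cover: "\<exists>(C', t) \<in> P'. y \<otimes> inv t \<in> C'" if y: "y \<in> K" for y
    proof -
      obtain D t where D: "(D, t) \<in> P" "y \<otimes> inv t \<in> D" using less.prems(4)[OF y] by auto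
      show ?thesis
      proof (cases "D = C")
        case False
        then show ?thesis using D unfolding P'_def R_def by blast
      next
        case True
        then have t: "t \<in> ?T" "y \<otimes> inv t \<in> C" using D by auto
        define r where "r = s t"
        have r: "r \<in> K" "r \<otimes> inv t \<in> C" using s[OF y t(2)] r_def by auto
        have c: "y \<in> carrier G" "r \<in> carrier G" "t \<in> carrier G" using y r K t T by auto
        define z where "z = y \<otimes> inv r"
        have zC: "z \<in> C" unfolding z_def by (rule subgroup_mult_invD[OF C t(2) r(2) c(1,2,3)])
        have zK: "z \<in> K" unfolding z_def using y r less.prems(2) by (simp add: subgroup_def)
        have zc: "z \<in> carrier G" using zK K by auto
        have "z \<otimes> x \<in> K" using zK x less.prems(2) by (simp add: subgroup_def)
        then obtain C' t' where C': "(C', t') \<in> P" "z \<otimes> x \<otimes> inv t' \<in> C'" using less.prems(4) by blast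
        have t'c: "t' \<in> carrier G" using less.prems(3)[OF C'(1)] by simp
        have "C' \<noteq> C"
        proof
          assume "C' = C"
          then have "inv z \<otimes> (z \<otimes> x \<otimes> inv t') \<in> C" using C' zC C by (simp add: subgroup_def)
          then have "x \<otimes> inv t' \<in> C" using zc xc t'c by (simp add: m_assoc)
          then show False using x(2)[of t'] C' \<open>C' = C\<close> by simp
        qed
        then have "(C', t') \<in> R" using C' R_def by simp
        then have "(C', t' \<otimes> inv x \<otimes> s t) \<in> P'" unfolding P'_def using t by force
        moreover have "y \<otimes> inv (t' \<otimes> inv x \<otimes> s t) \<in> C'"
          using C'(2) c xc t'c unfolding z_def r_def[symmetric] by (simp add: inv_mult_group m_assoc)
        ultimately show ?thesis by blast
      qed
    qed
    have "\<exists>C\<in>fst ` P'. almost_contained G K C"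
    proof (rule less.hyps[OF lt _ less.prems(2) _ cover])
      show "finite P'" unfolding P'_def using R T by auto
      have sG: "s t \<in> carrier G" for t using sK K by blast
      have RG: "subgroup C' G \<and> t \<in> carrier G" if "(C', t) \<in> R" for C' t
        using less.prems(3) R(2) that by blast
      fix C' t assume "(C', t) \<in> P'"
      then consider "(C', t) \<in> R" | t' t'' where "(C', t') \<in> R" "t = t' \<otimes> inv x \<otimes> s t''"
        unfolding P'_def by auto
      then show "subgroup C' G \<and> t \<in> carrier G"
        using RG sG xc by cases (blast, metis inv_closed m_closed)
    qed
    then show ?thesis using fst by blast
  qed
qed

section \<open>Almost centralizers and their symmetry\<close>

lemma centralizer_singleton_sym:
  "x \<in> carrier G \<Longrightarrow> y \<in> centralizer G {x} \<Longrightarrow> x \<in> centralizer G {y}"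
  by (auto simp: centralizer_def)

text \<open>Closure under inverses and products reflects that the centralizer of \<open>a\<close>
  lies in that of \<open>inv a\<close>, and that the centralizers of \<open>a\<close> and
  \<open>b\<close> intersect inside that of \<open>a \<otimes> b\<close>.\<close>

lemma subgroup_almost_centralizer:
  assumes "A \<subseteq> carrier G"
  shows "subgroup (almost_centralizer G A) G"
proof (rule subgroupI)
  show "almost_centralizer G A \<subseteq> carrier G" by (auto simp: almost_centralizer_def)
  have "centralizer G {\<one>} = carrier G" by (auto simp: centralizer_def)
  then have "\<one> \<in> almost_centralizer G A"
    using almost_contained_subset[OF subgroup_self assms] by (auto simp: almost_centralizer_def)
  then show "almost_centralizer G A \<noteq> {}" by blast
  fix a b assume a: "a \<in> almost_centralizer G A"
  then have ac: "a \<in> carrier G" by (simp add: almost_centralizer_def)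
  have "centralizer G {a} \<subseteq> centralizer G {inv a}"
  proof
    fix y assume y: "y \<in> centralizer G {a}"
    then have "inv a \<in> centralizer G {y}"
      by (intro subgroup.m_inv_closed[OF subgroup_centralizer centralizer_singleton_sym[OF ac]])
        (auto simp: centralizer_def)
    then show "y \<in> centralizer G {inv a}" using y by (auto simp: centralizer_def)
  qed
  then show "inv a \<in> almost_centralizer G A"
    using a ac almost_contained_mono[OF _ subset_refl] unfolding almost_centralizer_def by blast
  assume b: "b \<in> almost_centralizer G A"
  then have bc: "b \<in> carrier G" by (simp add: almost_centralizer_def)
  have "centralizer G {a} \<inter> centralizer G {b} \<subseteq> centralizer G {a \<otimes> b}"
  proof
    fix y assume y: "y \<in> centralizer G {a} \<inter> centralizer G {b}"
    then have "a \<in> centralizer G {y}" "b \<in> centralizer G {y}" "y \<in> carrier G"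
      using ac bc by (simp_all add: centralizer_def)
    then have "a \<otimes> b \<in> centralizer G {y}"
      using subgroup.m_closed[OF subgroup_centralizer[of "{y}"]] by blast
    then show "y \<in> centralizer G {a \<otimes> b}" using y by (auto simp: centralizer_def)
  qed
  moreover have "almost_contained G A (centralizer G {a} \<inter> centralizer G {b})"
    by (intro almost_contained_Int subgroup_centralizer)
      (use a b assms in \<open>simp_all add: almost_centralizer_def\<close>)
  ultimately show "a \<otimes> b \<in> almost_centralizer G A"
    using ac bc almost_contained_mono[OF _ subset_refl] unfolding almost_centralizer_def by blast
qed

text \<open>Otherwise there are \<open>d + 1\<close> elements of \<open>H\<close> in different
  cosets of the almost centralizer of \<open>K\<close>. By the pigeonhole principle every
  \<open>k\<close> in \<open>K\<close> commutes with some \<open>u \<otimes> inv v\<close> formed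
  from two of them, so finitely many centralizers cover \<open>K\<close>. By the covering lemma one
  of them almost contains \<open>K\<close>, which puts its \<open>u \<otimes> inv v\<close> into the
  almost centralizer.\<close>

lemma index_le_almost_centralizer:
  assumes "subgroup H G" "subgroup K G"
    and bound: "\<And>k. k \<in> K \<Longrightarrow> index_le G H (centralizer G {k}) d"
  shows "index_le G H (almost_centralizer G K) d"
proof (rule ccontr)
  assume not: "\<not> ?thesis"
  have HK: "H \<subseteq> carrier G" "K \<subseteq> carrier G" using assms(1,2) by (auto simp: subgroup_def)
  obtain U where U: "U \<subseteq> H" "finite U" "card U = Suc d"
    "\<And>u v. u \<in> U \<Longrightarrow> v \<in> U \<Longrightarrow> u \<noteq> v \<Longrightarrow> u \<otimes> inv v \<notin> almost_centralizer G K"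
    by (rule not_index_leE[OF not subgroup_almost_centralizer[OF HK(2)] HK(1)]) blast
  define P where "P = (\<lambda>(u, v). (centralizer G {u \<otimes> inv v}, \<one>)) ` {(u, v) \<in> U \<times> U. u \<noteq> v}"
  have Uc: "u \<in> carrier G" if "u \<in> U" for u using that U HK by auto
  have cover: "\<exists>(C, t) \<in> P. k \<otimes> inv t \<in> C" if k: "k \<in> K" for k
  proof -
    have kc: "k \<in> carrier G" using k HK by auto
    obtain u v where uv: "u \<in> U" "v \<in> U" "u \<noteq> v" "u \<otimes> inv v \<in> centralizer G {k}"
      using index_le_pigeonhole[OF bound[OF k] subgroup_centralizer U(1) HK(1)] U(3) kc by auto
    then have "k \<in> centralizer G {u \<otimes> inv v}" using centralizer_singleton_sym[OF kc] by blast
    then show ?thesis using uv kc unfolding P_def by force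
  qed
  have "\<exists>C\<in>fst ` P. almost_contained G K C"
  proof (rule almost_contained_of_finite_cover[OF _ assms(2) _ cover])
    show "finite P" unfolding P_def
      by (rule finite_imageI) (rule finite_subset[of _ "U \<times> U"], use U in auto)
    fix C t assume "(C, t) \<in> P"
    then show "subgroup C G \<and> t \<in> carrier G" unfolding P_def using Uc by (auto intro!: subgroup_centralizer)
  qed
  then obtain u v where uv: "u \<in> U" "v \<in> U" "u \<noteq> v" "almost_contained G K (centralizer G {u \<otimes> inv v})"
    unfolding P_def by auto
  then show False using U(4)[OF uv(1-3)] Uc by (simp add: almost_centralizer_def)
qed

end

section \<open>Envelopes of almost abelian subgroups\<close>

lemma centralizer_antimono: "S \<subseteq> T \<Longrightarrow> centralizer G T \<subseteq> centralizer G S"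
  unfolding centralizer_def by auto

section \<open>Conjugacy classes of bounded size\<close>

context group
begin

text \<open>The conjugate \<open>inv y \<otimes> x \<otimes> y\<close> depends only on the right
  coset of \<open>y\<close> modulo the centralizer of \<open>x\<close>.\<close>

lemma card_conjugates_le:
  assumes "index_le G F (centralizer G {x}) m" "x \<in> carrier G" "F \<subseteq> carrier G"
  shows "finite ((\<lambda>y. inv y \<otimes> x \<otimes> y) ` F) \<and> card ((\<lambda>y. inv y \<otimes> x \<otimes> y) ` F) \<le> m"
proof -
  obtain T where T: "T \<subseteq> carrier G" "finite T" "card T \<le> m"
    "\<And>y. y \<in> F \<Longrightarrow> \<exists>t\<in>T. y \<otimes> inv t \<in> centralizer G {x}"
    using assms(1) unfolding index_le_def by auto
  have "(\<lambda>y. inv y \<otimes> x \<otimes> y) ` F \<subseteq> (\<lambda>y. inv y \<otimes> x \<otimes> y) ` T"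
  proof clarify
    fix y assume "y \<in> F"
    then obtain t where t: "t \<in> T" "y \<otimes> inv t \<in> centralizer G {x}" using T(4) by blast
    define c where "c = y \<otimes> inv t"
    have c: "y \<in> carrier G" "t \<in> carrier G" "c \<in> carrier G" "c \<otimes> x = x \<otimes> c"
      using t T(1) assms(3) \<open>y \<in> F\<close> unfolding c_def by (auto simp: centralizer_def)
    have yc: "y = c \<otimes> t" unfolding c_def using c(1,2) by (simp add: m_assoc)
    have "inv y \<otimes> x \<otimes> y = inv t \<otimes> (inv c \<otimes> (x \<otimes> c)) \<otimes> t"
      unfolding yc using c(2,3) assms(2) by (simp add: inv_mult_group m_assoc)
    also have "x \<otimes> c = c \<otimes> x" using c by simp
    finally have "inv y \<otimes> x \<otimes> y = inv t \<otimes> x \<otimes> t" using c(2,3) assms(2) by simp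
    then show "inv y \<otimes> x \<otimes> y \<in> (\<lambda>y. inv y \<otimes> x \<otimes> y) ` T" using t by blast
  qed
  then show ?thesis
    using T finite_subset card_mono[OF finite_imageI[OF T(2)]] card_image_le[OF T(2)]
    by (meson finite_imageI le_trans)
qed

text \<open>One half of B. H. Neumann's theorem on groups with boundedly finite conjugacy classes. A
  largest class \<open>cl a\<close> is compared with the classes of products
  \<open>x \<otimes> a\<close>, where \<open>x\<close> commutes with the finitely many elements of
  \<open>B\<close> that produce all conjugates of \<open>a\<close>.\<close>

lemma finite_commutators:
  assumes F: "subgroup F G"
    and bound: "\<And>x. x \<in> F \<Longrightarrow> index_le G F (centralizer G {x}) m"
  shows "finite {x \<otimes> y \<otimes> inv x \<otimes> inv y | x y. x \<in> F \<and> y \<in> F}"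
proof -
  have Fc: "x \<in> carrier G" if "x \<in> F" for x using F that by (simp add: subgroup.mem_carrier)
  have FsubG: "F \<subseteq> carrier G" using Fc by blast
  define cl where "cl = (\<lambda>x. (\<lambda>y. inv y \<otimes> x \<otimes> y) ` F)"
  have cl: "finite (cl x)" "card (cl x) \<le> m" if "x \<in> F" for x
    using card_conjugates_le[OF bound[OF that] Fc[OF that] FsubG] unfolding cl_def by auto
  have clF: "cl x \<subseteq> F" if "x \<in> F" for x
    unfolding cl_def using that F by (auto simp: subgroup_def)
  have "\<exists>a. a \<in> F \<and> (\<forall>x. x \<in> F \<longrightarrow> card (cl x) \<le> card (cl a))"
    by (rule ex_has_greatest_nat[of "\<lambda>x. x \<in> F" \<one> "\<lambda>x. card (cl x)" "Suc m"])
      (use F cl(2) in \<open>auto simp: subgroup_def less_Suc_eq_le\<close>)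
  then obtain a where a: "a \<in> F" "\<And>x. x \<in> F \<Longrightarrow> card (cl x) \<le> card (cl a)" by blast
  obtain B where B: "B \<subseteq> F" "finite B" "cl a = (\<lambda>y. inv y \<otimes> a \<otimes> y) ` B"
    using finite_subset_image[of "cl a" "\<lambda>y. inv y \<otimes> a \<otimes> y" F] cl(1)[OF a(1)] unfolding cl_def by auto
  define S where "S = (\<lambda>(u, v). u \<otimes> inv v) ` (cl a \<times> cl a)"
  have S: "finite S" unfolding S_def using cl(1)[OF a(1)] by simp
  have inS: "inv x \<otimes> inv y \<otimes> x \<otimes> y \<in> S" if x: "x \<in> F" "x \<in> centralizer G B" and y: "y \<in> F" for x y
  proof -
    have xa: "x \<otimes> a \<in> F" using x a F by (simp add: subgroup_def)
    \<comment> \<open>Since \<open>x\<close> commutes with \<open>b\<close>, conjugating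
      \<open>x \<otimes> a\<close> by \<open>b\<close> multiplies the conjugate of \<open>a\<close>
      by \<open>x\<close> on the left.\<close>
    have sub: "(\<lambda>u. x \<otimes> u) ` cl a \<subseteq> cl (x \<otimes> a)"
    proof clarify
      fix u assume "u \<in> cl a"
      then obtain b where b: "b \<in> B" "u = inv b \<otimes> a \<otimes> b" using B by auto
      have c: "b \<in> F" "x \<otimes> b = b \<otimes> x" using b x B by (auto simp: centralizer_def)
      have "inv b \<otimes> (x \<otimes> a) \<otimes> b = inv b \<otimes> (x \<otimes> b) \<otimes> (inv b \<otimes> a \<otimes> b)"
        using Fc c(1) x(1) a(1) by (simp add: m_assoc)
      also have "\<dots> = x \<otimes> u"
        unfolding c(2) b(2) using Fc c(1) x(1) a(1) by (simp add: m_assoc)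
      finally show "x \<otimes> u \<in> cl (x \<otimes> a)"
        unfolding cl_def by (intro image_eqI[OF _ c(1)]) (rule sym)
    qed
    have "inj_on (\<lambda>u. x \<otimes> u) (cl a)"
      using Fc[OF x(1)] clF[OF a(1)] FsubG by (intro inj_onI) (simp add: subset_iff)
    then have "card ((\<lambda>u. x \<otimes> u) ` cl a) = card (cl a)" by (rule card_image)
    \<comment> \<open>The class of \<open>x \<otimes> a\<close> has at most as many elements as the
      maximal class \<open>cl a\<close>, so the inclusion is an equality.\<close>
    then have eq: "(\<lambda>u. x \<otimes> u) ` cl a = cl (x \<otimes> a)"
      using card_subset_eq[OF cl(1)[OF xa] sub] a(2)[OF xa] card_mono[OF cl(1)[OF xa] sub] by simp
    have "inv y \<otimes> (x \<otimes> a) \<otimes> y \<in> cl (x \<otimes> a)" unfolding cl_def using y by blast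
    then obtain u where u: "u \<in> cl a" "inv y \<otimes> (x \<otimes> a) \<otimes> y = x \<otimes> u" using eq by blast
    define v where "v = inv y \<otimes> a \<otimes> y"
    have v: "v \<in> cl a" unfolding v_def cl_def using y by blast
    have c: "x \<in> carrier G" "y \<in> carrier G" "a \<in> carrier G" "u \<in> carrier G" "v \<in> carrier G"
      using Fc x y a u(1) v clF[OF a(1)] by auto
    \<comment> \<open>The commutator of \<open>x\<close> and \<open>y\<close> is read off from the
      conjugates of \<open>x \<otimes> a\<close> and of \<open>a\<close> by \<open>y\<close>; it
      becomes a quotient of two members of \<open>cl a\<close>.\<close>
    have "inv x \<otimes> inv y \<otimes> x \<otimes> y = inv x \<otimes> (inv y \<otimes> (x \<otimes> a) \<otimes> y) \<otimes> inv v"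
      using c(1-3) unfolding v_def by (simp add: inv_mult_group m_assoc)
    also have "\<dots> = u \<otimes> inv v" unfolding u(2) using c by (simp add: m_assoc)
    finally show ?thesis unfolding S_def using u(1) v by auto
  qed
  have ac: "almost_contained G F (centralizer G {x})" if "x \<in> F" for x
    using bound[OF that] unfolding almost_contained_def by blast
  have BG: "B \<subseteq> carrier G" using B(1) FsubG by blast
  have "almost_contained G F (centralizer G B)"
    by (rule almost_contained_centralizer_finite[OF B(2) BG FsubG]) (use B(1) ac in blast)
  then have "almost_contained G F (F \<inter> centralizer G B)"
    using almost_contained_Int[OF almost_contained_subset[OF F subset_refl]] FsubG F
      subgroup_centralizer[OF BG] by blast
  then obtain T where T: "T \<subseteq> carrier G" "finite T"
    "\<And>x. x \<in> F \<Longrightarrow> \<exists>t\<in>T. x \<otimes> inv t \<in> F \<inter> centralizer G B"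
    by (rule almost_containedE) blast
  \<comment> \<open>An arbitrary \<open>x\<close> in \<open>F\<close> is
    \<open>z \<otimes> c\<close> with \<open>z\<close> commuting with \<open>B\<close> and
    \<open>c\<close> in a finite set. Its commutator with \<open>y\<close> is \<open>inv c\<close>,
    times a commutator of \<open>z\<close> in \<open>S\<close>, times a conjugate of
    \<open>c\<close>.\<close>
  define R where "R = (\<lambda>(c, s, w). inv c \<otimes> s \<otimes> w) ` (SIGMA c:T \<inter> F. S \<times> cl c)"
  have R: "finite R" unfolding R_def using T(2) S cl(1) by auto
  have inR: "inv x \<otimes> inv y \<otimes> x \<otimes> y \<in> R" if x: "x \<in> F" and y: "y \<in> F" for x y
  proof -
    obtain c where c: "c \<in> T" "x \<otimes> inv c \<in> F" "x \<otimes> inv c \<in> centralizer G B" using T(3)[OF x] by blast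
    define z where "z = x \<otimes> inv c"
    have cc: "c \<in> carrier G" using c T by auto
    have "inv (x \<otimes> inv c) \<otimes> x \<in> F" using c x F by (simp add: subgroup_def)
    then have cF: "c \<in> F" using cc Fc[OF x] by (simp add: inv_mult_group m_assoc)
    have "inv z \<otimes> inv y \<otimes> z \<otimes> y \<in> S" using inS c y unfolding z_def by blast
    moreover have "inv y \<otimes> c \<otimes> y \<in> cl c" unfolding cl_def using y by blast
    moreover have "inv x \<otimes> inv y \<otimes> x \<otimes> y = inv c \<otimes> (inv z \<otimes> inv y \<otimes> z \<otimes> y) \<otimes> (inv y \<otimes> c \<otimes> y)"
      unfolding z_def using Fc x y cc by (simp add: inv_mult_group m_assoc)
    ultimately show ?thesis unfolding R_def using c cF by force
  qed
  have "{x \<otimes> y \<otimes> inv x \<otimes> inv y | x y. x \<in> F \<and> y \<in> F} \<subseteq> R"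
  proof clarify
    fix x y assume "x \<in> F" "y \<in> F"
    then show "x \<otimes> y \<otimes> inv x \<otimes> inv y \<in> R"
      using inR[of "inv x" "inv y"] F Fc by (simp add: subgroup_def)
  qed
  then show ?thesis using R finite_subset by blast
qed

text \<open>This is the centralizer in \<open>F\<close> of the derived subgroup of \<open>F\<close>,
  stated through its generators so that a formula can describe it. For a subgroup \<open>F\<close>
  its own commutators are central in it, so it is nilpotent of class at most 2.\<close>

definition commutator_centralizer :: "'a set \<Rightarrow> 'a set" where
  "commutator_centralizer F = F \<inter> centralizer G {x \<otimes> y \<otimes> inv x \<otimes> inv y | x y. x \<in> F \<and> y \<in> F}"

lemma subgroup_commutator_centralizer:
  assumes "subgroup F G"
  shows "subgroup (commutator_centralizer F) G"
proof -
  have "{x \<otimes> y \<otimes> inv x \<otimes> inv y | x y. x \<in> F \<and> y \<in> F} \<subseteq> carrier G"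
    using subgroup.mem_carrier[OF assms] by auto
  then show ?thesis unfolding commutator_centralizer_def
    by (intro subgroups_Inter_pair assms subgroup_centralizer)
qed

text \<open>There are only finitely many commutators, they lie in \<open>F\<close>, and the
  centralizer of each of them almost contains \<open>F\<close>.\<close>

lemma almost_contained_commutator_centralizer:
  assumes F: "subgroup F G"
    and bound: "\<And>x. x \<in> F \<Longrightarrow> index_le G F (centralizer G {x}) m"
  shows "almost_contained G F (commutator_centralizer F)"
proof -
  have FsubG: "F \<subseteq> carrier G" using F by (simp add: subgroup.subset)
  define C where "C = {x \<otimes> y \<otimes> inv x \<otimes> inv y | x y. x \<in> F \<and> y \<in> F}"
  have C: "C \<subseteq> F" "finite C" unfolding C_def
    using F finite_commutators[OF F bound] by (auto simp: subgroup_def)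
  have "almost_contained G F (centralizer G {x})" if "x \<in> F" for x
    using bound[OF that] unfolding almost_contained_def by blast
  then have "almost_contained G F (centralizer G C)"
    using C FsubG by (meson almost_contained_centralizer_finite subset_trans subsetD)
  then show ?thesis unfolding commutator_centralizer_def C_def[symmetric]
    using almost_contained_subset[OF F subset_refl] almost_contained_Int[OF _ _ FsubG F]
      subgroup_centralizer C(1) FsubG by blast
qed

section \<open>Conjugation and the envelope of an almost abelian subgroup\<close>

lemma conj_centralizer:
  assumes "h \<in> carrier G" "S \<subseteq> carrier G" "x \<in> centralizer G S"
  shows "h \<otimes> x \<otimes> inv h \<in> centralizer G ((\<lambda>s. h \<otimes> s \<otimes> inv h) ` S)"
proof -
  have "h \<otimes> x \<otimes> inv h \<otimes> (h \<otimes> s \<otimes> inv h) = h \<otimes> s \<otimes> inv h \<otimes> (h \<otimes> x \<otimes> inv h)" if "s \<in> S" for s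
  proof -
    have c: "s \<in> carrier G" "x \<in> carrier G" "x \<otimes> s = s \<otimes> x"
      using that assms by (auto simp: centralizer_def)
    have "h \<otimes> x \<otimes> inv h \<otimes> (h \<otimes> s \<otimes> inv h) = h \<otimes> (x \<otimes> s) \<otimes> inv h"
      using assms(1) c(1,2) by (simp add: m_assoc)
    also have "\<dots> = h \<otimes> s \<otimes> inv h \<otimes> (h \<otimes> x \<otimes> inv h)"
      unfolding c(3) using assms(1) c(1,2) by (simp add: m_assoc)
    finally show ?thesis .
  qed
  then show ?thesis using assms by (auto simp: centralizer_def)
qed

lemma conj_inv_cancel:
  assumes "h \<in> carrier G" "x \<in> carrier G"
  shows "h \<otimes> (inv h \<otimes> x \<otimes> h) \<otimes> inv h = x" "inv h \<otimes> (h \<otimes> x \<otimes> inv h) \<otimes> h = x"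
  using assms by (simp_all add: m_assoc)

lemma conj_mult:
  assumes "h \<in> carrier G" "x \<in> carrier G" "y \<in> carrier G"
  shows "h \<otimes> x \<otimes> inv h \<otimes> (h \<otimes> y \<otimes> inv h) = h \<otimes> (x \<otimes> y) \<otimes> inv h"
  using assms by (simp add: m_assoc)

lemma conj_inv:
  assumes "h \<in> carrier G" "x \<in> carrier G"
  shows "inv (h \<otimes> x \<otimes> inv h) = h \<otimes> inv x \<otimes> inv h"
  using assms by (simp add: inv_mult_group m_assoc)

lemma almost_contained_conj:
  assumes "almost_contained G A (centralizer G S)" "h \<in> carrier G" "A \<subseteq> carrier G" "S \<subseteq> carrier G"
  shows "almost_contained G ((\<lambda>a. h \<otimes> a \<otimes> inv h) ` A) (centralizer G ((\<lambda>s. h \<otimes> s \<otimes> inv h) ` S))"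
proof -
  obtain T where T: "T \<subseteq> carrier G" "finite T" "\<And>x. x \<in> A \<Longrightarrow> \<exists>t\<in>T. x \<otimes> inv t \<in> centralizer G S"
    using almost_containedE[OF assms(1)] by metis
  show ?thesis
  proof (rule almost_containedI[of "(\<lambda>a. h \<otimes> a \<otimes> inv h) ` T"])
    show "(\<lambda>a. h \<otimes> a \<otimes> inv h) ` T \<subseteq> carrier G" using T assms(2) by auto
    show "finite ((\<lambda>a. h \<otimes> a \<otimes> inv h) ` T)" using T by simp
    fix x assume "x \<in> (\<lambda>a. h \<otimes> a \<otimes> inv h) ` A"
    then obtain a where a: "a \<in> A" "x = h \<otimes> a \<otimes> inv h" by auto
    obtain t where t: "t \<in> T" "a \<otimes> inv t \<in> centralizer G S" using T(3)[OF a(1)] by blast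
    have c: "a \<in> carrier G" "t \<in> carrier G" using a t T assms by auto
    have "x \<otimes> inv (h \<otimes> t \<otimes> inv h) = h \<otimes> (a \<otimes> inv t) \<otimes> inv h"
      unfolding a(2) using c assms(2) by (simp add: conj_inv conj_mult)
    then have "x \<otimes> inv (h \<otimes> t \<otimes> inv h) \<in> centralizer G ((\<lambda>s. h \<otimes> s \<otimes> inv h) ` S)"
      using conj_centralizer[OF assms(2,4) t(2)] by simp
    then show "\<exists>t\<in>(\<lambda>a. h \<otimes> a \<otimes> inv h) ` T. x \<otimes> inv t \<in> centralizer G ((\<lambda>s. h \<otimes> s \<otimes> inv h) ` S)"
      using t(1) by blast
  qed
qed

text \<open>The consequence of the chain condition used for the quotients \<open>K/N\<close>.\<close>

definition almost_minimal_centralizers :: "nat \<Rightarrow> bool" where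
  "almost_minimal_centralizers d \<longleftrightarrow>
     (\<forall>A. A \<subseteq> carrier G \<and> A \<noteq> {} \<longrightarrow>
        (\<exists>S \<subseteq> A. finite S \<and> (\<forall>x\<in>A. index_le G (centralizer G S) (centralizer G {x}) d)))"

text \<open>The chain condition, applied to the almost centralizer itself, gives a finite subset
  \<open>S\<close> of it. Covering \<open>E\<close> by \<open>k\<close> cosets of the centralizer of
  \<open>S\<close>, and that centralizer by \<open>d\<close> cosets of the centralizer of any
  \<open>x\<close>, yields the common bound \<open>k * d\<close>.\<close>

lemma index_le_centralizer_uniform:
  assumes "almost_minimal_centralizers d" "E \<subseteq> carrier G"
  shows "\<exists>m. \<forall>x\<in>almost_centralizer G E. index_le G E (centralizer G {x}) m"
proof -
  have sub: "almost_centralizer G E \<subseteq> carrier G" by (auto simp: almost_centralizer_def)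
  moreover have "almost_centralizer G E \<noteq> {}"
    using subgroup.one_closed[OF subgroup_almost_centralizer[OF assms(2)]] by blast
  ultimately obtain S where S: "S \<subseteq> almost_centralizer G E" "finite S"
    "\<And>x. x \<in> almost_centralizer G E \<Longrightarrow> index_le G (centralizer G S) (centralizer G {x}) d"
    using assms(1) unfolding almost_minimal_centralizers_def by metis
  have "almost_contained G E (centralizer G S)"
  proof (rule almost_contained_centralizer_finite[OF S(2) _ assms(2)])
    show "S \<subseteq> carrier G" using S(1) sub by blast
    fix s assume "s \<in> S"
    then show "almost_contained G E (centralizer G {s})"
      using S(1) by (auto simp: almost_centralizer_def)
  qed
  then obtain k where "index_le G E (centralizer G S) k" unfolding almost_contained_def by blast
  then show ?thesis using index_le_trans S(3) assms(2) by blast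
qed

text \<open>Conjugation moves the almost containment of \<open>E\<close> to its conjugate, so the
  almost centralizer is invariant as soon as \<open>E\<close> is almost contained in the
  conjugate.\<close>

lemma almost_centralizer_conj:
  assumes "x \<in> almost_centralizer G E" "h \<in> carrier G" "E \<subseteq> carrier G"
    "almost_contained G E ((\<lambda>a. h \<otimes> a \<otimes> inv h) ` E)"
  shows "h \<otimes> x \<otimes> inv h \<in> almost_centralizer G E"
proof -
  have x: "x \<in> carrier G" "almost_contained G E (centralizer G {x})"
    using assms(1) by (auto simp: almost_centralizer_def)
  have "almost_contained G ((\<lambda>a. h \<otimes> a \<otimes> inv h) ` E) (centralizer G {h \<otimes> x \<otimes> inv h})"
    using almost_contained_conj[OF x(2) assms(2,3)] x(1) by simp
  then show ?thesis
    using almost_contained_trans[OF assms(4)] assms(2,3) x(1) by (simp add: almost_centralizer_def)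
qed

text \<open>The intermediate sets and the bounds \<open>M\<close>, \<open>M'\<close> are exported
  with their descriptions because definability of \<open>D\<close> is derived from them, after
  passing to preimages in the ambient group.\<close>

lemma almost_abelian_envelope:
  assumes min: "almost_minimal_centralizers d"
    and A: "subgroup A G" "\<And>a. a \<in> A \<Longrightarrow> almost_contained G A (centralizer G {a})"
    and H: "subgroup H G" "\<And>h a. h \<in> H \<Longrightarrow> a \<in> A \<Longrightarrow> h \<otimes> a \<otimes> inv h \<in> A"
  obtains S E F M F' M' D where
    "finite S" "S \<subseteq> carrier G" "E = centralizer G S"
    "F = {x \<in> carrier G. index_le G E (centralizer G {x}) M}"
    "F' = {x \<in> F. index_le G F (centralizer G {x}) M'}"
    "D = commutator_centralizer F'"
    "subgroup F G" "subgroup F' G"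
    "almost_contained G A D"
    "\<And>h x. h \<in> H \<Longrightarrow> x \<in> D \<Longrightarrow> h \<otimes> x \<otimes> inv h \<in> D"
proof -
  have AG: "A \<subseteq> carrier G" using A(1) by (simp add: subgroup.subset)
  have HG: "h \<in> carrier G" "inv h \<in> H" if "h \<in> H" for h
    using H(1) that by (auto simp: subgroup_def)
  have "A \<noteq> {}" using A(1) subgroup.one_closed by blast
  then obtain S where S: "S \<subseteq> A" "finite S"
    "\<And>x. x \<in> A \<Longrightarrow> index_le G (centralizer G S) (centralizer G {x}) d"
    using min AG unfolding almost_minimal_centralizers_def by metis
  define E where "E = centralizer G S"
  have E: "subgroup E G" unfolding E_def using S AG by (intro subgroup_centralizer) auto
  have EG: "E \<subseteq> carrier G" using E by (simp add: subgroup.subset)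
  have AE: "almost_contained G A E"
    unfolding E_def
    by (rule almost_contained_centralizer_finite[OF S(2) _ AG]) (use S(1) AG A(2) in blast)+
  define F where "F = almost_centralizer G E"
  have F: "subgroup F G" unfolding F_def by (rule subgroup_almost_centralizer[OF EG])
  have FG: "F \<subseteq> carrier G" using F by (simp add: subgroup.subset)
  have AF: "A \<subseteq> F"
    unfolding F_def almost_centralizer_def almost_contained_def E_def using S(3) AG by blast
  \<comment> \<open>The uniform bound turns finiteness of an index into a condition of bounded
    index, the form that can be defined.\<close>
  obtain M where M: "\<And>x. x \<in> F \<Longrightarrow> index_le G E (centralizer G {x}) M"
    using index_le_centralizer_uniform[OF min EG] unfolding F_def by blast
  have F_eq: "F = {x \<in> carrier G. index_le G E (centralizer G {x}) M}"
    using M FG unfolding F_def almost_centralizer_def almost_contained_def by blast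
  define F' where "F' = F \<inter> almost_centralizer G F"
  have F': "subgroup F' G" unfolding F'_def
    by (intro subgroups_Inter_pair F subgroup_almost_centralizer FG)
  have F'G: "F' \<subseteq> carrier G" using F' by (simp add: subgroup.subset)
  \<comment> \<open>Symmetry: every element of \<open>F\<close> is almost centralized by
    \<open>E\<close> with the same bound, hence almost all of \<open>E\<close> almost centralizes
    \<open>F\<close>.\<close>
  have "almost_contained G E (almost_centralizer G F)"
    using index_le_almost_centralizer[OF E F M] unfolding almost_contained_def by blast
  then have "almost_contained G A (almost_centralizer G F)"
    using almost_contained_trans[OF AE] AG by blast
  then have AF': "almost_contained G A F'"
    unfolding F'_def using almost_contained_subset[OF F AF] AG
    by (intro almost_contained_Int F subgroup_almost_centralizer FG)
  obtain M' where M': "\<And>x. x \<in> almost_centralizer G F \<Longrightarrow> index_le G F (centralizer G {x}) M'"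
    using index_le_centralizer_uniform[OF min FG] by blast
  have F'_eq: "F' = {x \<in> F. index_le G F (centralizer G {x}) M'}"
    using M' FG unfolding F'_def almost_centralizer_def almost_contained_def by blast
  have "index_le G F' (centralizer G {x}) M'" if "x \<in> F'" for x
    using M'[of x] that index_le_mono[of G F "centralizer G {x}" M' F'] unfolding F'_def by blast
  then have "almost_contained G F' (commutator_centralizer F')"
    by (intro almost_contained_commutator_centralizer F')
  then have AD: "almost_contained G A (commutator_centralizer F')"
    using almost_contained_trans[OF AF'] AG by blast
  \<comment> \<open>The conjugate of \<open>S\<close> is again a finite subset of \<open>A\<close>,
    and \<open>E\<close> is almost contained in the centralizer of each element of \<open>A\<close>;
    so \<open>E\<close> is almost contained in the centralizer of the conjugate of \<open>S\<close>,
    which lies in the conjugate of \<open>E\<close>.\<close>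
  have EE: "almost_contained G E ((\<lambda>a. h \<otimes> a \<otimes> inv h) ` E)" if h: "h \<in> H" for h
  proof -
    have hG: "h \<in> carrier G" using HG h by blast
    have hS: "(\<lambda>s. h \<otimes> s \<otimes> inv h) ` S \<subseteq> A" using H(2)[OF h] S(1) by auto
    have "almost_contained G E (centralizer G {a})" if "a \<in> A" for a
      using S(3)[OF that] unfolding E_def almost_contained_def by blast
    then have "almost_contained G E (centralizer G ((\<lambda>s. h \<otimes> s \<otimes> inv h) ` S))"
      using almost_contained_centralizer_finite[OF finite_imageI[OF S(2)] _ EG] hS AG
      by (meson subset_trans subsetD)
    moreover have "centralizer G ((\<lambda>s. h \<otimes> s \<otimes> inv h) ` S) \<subseteq> (\<lambda>a. h \<otimes> a \<otimes> inv h) ` E"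
    proof
      fix x assume x: "x \<in> centralizer G ((\<lambda>s. h \<otimes> s \<otimes> inv h) ` S)"
      have xG: "x \<in> carrier G" using x unfolding centralizer_def by blast
      have SG: "S \<subseteq> carrier G" using S AG by blast
      have "inv h \<otimes> x \<otimes> inv (inv h) \<in> centralizer G ((\<lambda>s. inv h \<otimes> s \<otimes> inv (inv h)) ` ((\<lambda>s. h \<otimes> s \<otimes> inv h) ` S))"
        using hG SG by (intro conj_centralizer x) auto
      moreover have "(\<lambda>s. inv h \<otimes> s \<otimes> inv (inv h)) ` ((\<lambda>s. h \<otimes> s \<otimes> inv h) ` S) = id ` S"
        unfolding image_image using hG SG by (intro image_cong) (auto simp: conj_inv_cancel subset_iff)
      ultimately have "inv h \<otimes> x \<otimes> h \<in> E" unfolding E_def using hG by simp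
      then show "x \<in> (\<lambda>a. h \<otimes> a \<otimes> inv h) ` E"
        using conj_inv_cancel(1)[OF hG xG] by (metis image_eqI)
    qed
    ultimately show ?thesis using almost_contained_mono by blast
  qed
  have conjF: "h \<otimes> x \<otimes> inv h \<in> F" if "h \<in> H" "x \<in> F" for h x
    using almost_centralizer_conj EE HG EG that unfolding F_def by blast
  have FF: "(\<lambda>a. h \<otimes> a \<otimes> inv h) ` F = F" if h: "h \<in> H" for h
  proof
    show "(\<lambda>a. h \<otimes> a \<otimes> inv h) ` F \<subseteq> F" using conjF h by blast
    show "F \<subseteq> (\<lambda>a. h \<otimes> a \<otimes> inv h) ` F"
    proof
      fix x assume x: "x \<in> F"
      have xG: "x \<in> carrier G" using x FG by blast
      have m: "inv h \<otimes> x \<otimes> h \<in> F" using conjF[OF HG(2)[OF h] x] HG(1)[OF h] by simp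
      show "x \<in> (\<lambda>a. h \<otimes> a \<otimes> inv h) ` F"
        by (rule image_eqI[where x = "inv h \<otimes> x \<otimes> h", OF _ m])
          (rule conj_inv_cancel(1)[OF HG(1)[OF h] xG, symmetric])
    qed
  qed
  have conjF': "h \<otimes> x \<otimes> inv h \<in> F'" if h: "h \<in> H" and x: "x \<in> F'" for h x
  proof -
    have "almost_contained G F ((\<lambda>a. h \<otimes> a \<otimes> inv h) ` F)"
      unfolding FF[OF h] by (rule almost_contained_subset[OF F subset_refl])
    then have "h \<otimes> x \<otimes> inv h \<in> almost_centralizer G F"
      using almost_centralizer_conj[OF _ HG(1)[OF h] FG] x unfolding F'_def by blast
    then show ?thesis using conjF[OF h] x unfolding F'_def by blast
  qed
  have conjD: "h \<otimes> x \<otimes> inv h \<in> commutator_centralizer F'"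
    if h: "h \<in> H" and x: "x \<in> commutator_centralizer F'" for h x
  proof -
    let ?C = "{x \<otimes> y \<otimes> inv x \<otimes> inv y | x y. x \<in> F' \<and> y \<in> F'}"
    have hG: "h \<in> carrier G" by (rule HG(1)[OF h])
    have CG: "?C \<subseteq> carrier G" using F'G by (auto intro!: m_closed inv_closed)
    \<comment> \<open>Since \<open>F'\<close> is also stable under conjugation by
      \<open>inv h\<close>, every commutator of \<open>F'\<close> is the conjugate by
      \<open>h\<close> of another one.\<close>
    have "?C \<subseteq> (\<lambda>s. h \<otimes> s \<otimes> inv h) ` ?C"
    proof clarify
      fix y z assume yz: "y \<in> F'" "z \<in> F'"
      define u where "u = inv h \<otimes> y \<otimes> h"
      define v where "v = inv h \<otimes> z \<otimes> h"
      have uv: "u \<in> F'" "v \<in> F'"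
        using conjF'[OF HG(2)[OF h]] yz hG unfolding u_def v_def by (metis inv_inv)+
      have G: "u \<in> carrier G" "v \<in> carrier G" using uv F'G by auto
      have "y = h \<otimes> u \<otimes> inv h" "z = h \<otimes> v \<otimes> inv h"
        unfolding u_def v_def using conj_inv_cancel(1)[OF hG] yz F'G by auto
      then have "y \<otimes> z \<otimes> inv y \<otimes> inv z = h \<otimes> (u \<otimes> v \<otimes> inv u \<otimes> inv v) \<otimes> inv h"
        using G hG by (simp add: conj_inv conj_mult)
      then show "y \<otimes> z \<otimes> inv y \<otimes> inv z \<in> (\<lambda>s. h \<otimes> s \<otimes> inv h) ` ?C" using uv by blast
    qed
    then have "centralizer G ((\<lambda>s. h \<otimes> s \<otimes> inv h) ` ?C) \<subseteq> centralizer G ?C"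
      by (rule centralizer_antimono)
    moreover have "h \<otimes> x \<otimes> inv h \<in> centralizer G ((\<lambda>s. h \<otimes> s \<otimes> inv h) ` ?C)"
      using x unfolding commutator_centralizer_def by (intro conj_centralizer hG CG) simp
    ultimately show ?thesis
      using conjF'[OF h] x unfolding commutator_centralizer_def by blast
  qed
  show thesis
    by (rule that[OF S(2) _ E_def F_eq F'_eq refl F F' AD conjD]) (use S(1) AG in auto)
qed

end

section \<open>Definable predicates\<close>

definition interleave :: "(nat \<Rightarrow> 'a) \<Rightarrow> (nat \<Rightarrow> 'a) \<Rightarrow> nat \<Rightarrow> 'a" where
  "interleave e c v = (if even v then e (v div 2) else c (v div 2))"

section \<open>Renaming of variables\<close>

primrec rename_term :: "(nat \<Rightarrow> nat) \<Rightarrow> 'f fo_term \<Rightarrow> 'f fo_term" where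
  "rename_term h (TVar v) = TVar (h v)"
| "rename_term h TOne = TOne"
| "rename_term h (TMult s t) = TMult (rename_term h s) (rename_term h t)"
| "rename_term h (TInv t) = TInv (rename_term h t)"
| "rename_term h (TFun f ts) = TFun f (map (rename_term h) ts)"

primrec rename_formula :: "(nat \<Rightarrow> nat) \<Rightarrow> ('f, 'r) fo_formula \<Rightarrow> ('f, 'r) fo_formula" where
  "rename_formula h (FEq s t) = FEq (rename_term h s) (rename_term h t)"
| "rename_formula h (FRel r ts) = FRel r (map (rename_term h) ts)"
| "rename_formula h (FNot p) = FNot (rename_formula h p)"
| "rename_formula h (FAnd p q) = FAnd (rename_formula h p) (rename_formula h q)"
| "rename_formula h (FEx v p) = FEx (h v) (rename_formula h p)"

lemma wf_rename_term: "wf_term F t \<Longrightarrow> wf_term F (rename_term h t)"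
  by (induction t) (auto simp: list_all_iff)

lemma wf_rename_formula: "wf_formula F R p \<Longrightarrow> wf_formula F R (rename_formula h p)"
  by (induction p) (auto simp: list_all_iff wf_rename_term)

lemma term_val_rename: "term_val G e (rename_term h t) = term_val G (\<lambda>v. e (h v)) t"
  by (induction t) (simp_all add: comp_def cong: map_cong)

text \<open>Bound variables are renamed together with the free ones, and injectivity prevents a
  quantifier from capturing another variable.\<close>

lemma satisfies_rename:
  "inj h \<Longrightarrow> satisfies G e (rename_formula h p) = satisfies G (\<lambda>v. e (h v)) p"
proof (induction p arbitrary: e)
  case (FEx v p)
  have upd: "(\<lambda>u. (e(h v := a)) (h u)) = (\<lambda>u. e (h u))(v := a)" for a
    using FEx.prems by (auto simp: fun_eq_iff inj_def)
  show ?case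
    unfolding rename_formula.simps satisfies.simps FEx.IH[OF FEx.prems] upd ..
qed (simp_all add: term_val_rename comp_def)

text \<open>Even variables carry the arguments of a predicate and odd ones its parameters, so that two
  formulas can be combined after renaming the parameters of each of them apart.\<close>

definition definable_fun ::
    "('a, 'f, 'r) group_structure \<Rightarrow> ((nat \<Rightarrow> 'a) \<Rightarrow> 'a) \<Rightarrow> bool" where
  "definable_fun G f \<longleftrightarrow> (\<exists>t c. wf_term (funs G) t \<and> range c \<subseteq> carrier G \<and>
     (\<forall>e. range e \<subseteq> carrier G \<longrightarrow> f e = term_val G (interleave e c) t))"

definition definable_pred ::
    "('a, 'f, 'r) group_structure \<Rightarrow> ((nat \<Rightarrow> 'a) \<Rightarrow> bool) \<Rightarrow> bool" where
  "definable_pred G P \<longleftrightarrow> (\<exists>p c. wf_formula (funs G) (rels G) p \<and> range c \<subseteq> carrier G \<and>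
     (\<forall>e. range e \<subseteq> carrier G \<longrightarrow> P e = satisfies G (interleave e c) p))"

text \<open>Arguments stay in place, while parameter \<open>i\<close> moves to parameter
  \<open>2 * i\<close>; \<open>shift2\<close> moves it to \<open>2 * i + 1\<close>. The new
  parameters are thus the interleaving of two parameter sequences.\<close>

definition shift1 :: "nat \<Rightarrow> nat" where
  "shift1 v = (if even v then v else 2 * (2 * (v div 2)) + 1)"

definition shift2 :: "nat \<Rightarrow> nat" where
  "shift2 v = (if even v then v else 2 * (2 * (v div 2) + 1) + 1)"

lemma inj_shift: "inj shift1" "inj shift2"
proof -
  have "u = v" if "shift1 u = shift1 v" for u v
    using that unfolding shift1_def by (auto split: if_splits elim!: evenE oddE) presburger+
  moreover have "u = v" if "shift2 u = shift2 v" for u v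
    using that unfolding shift2_def by (auto split: if_splits elim!: evenE oddE) presburger+
  ultimately show "inj shift1" "inj shift2" by (blast intro: injI)+
qed

lemma interleave_shift:
  "(\<lambda>v. interleave e (interleave c1 c2) (shift1 v)) = interleave e c1"
  "(\<lambda>v. interleave e (interleave c1 c2) (shift2 v)) = interleave e c2"
  by (auto simp: fun_eq_iff interleave_def shift1_def shift2_def elim!: oddE)

lemma range_interleave:
  "range c1 \<subseteq> A \<Longrightarrow> range c2 \<subseteq> A \<Longrightarrow> range (interleave c1 c2) \<subseteq> A"
  by (auto simp: interleave_def)

lemma interleave_upd: "(interleave e c)(2 * v := a) = interleave (e(v := a)) c"
  by (auto simp: fun_eq_iff interleave_def)

section \<open>Closure properties of definable predicates and functions\<close>

lemma definable_pred_cong: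
  assumes "definable_pred G P" "\<And>e. range e \<subseteq> carrier G \<Longrightarrow> P e = Q e"
  shows "definable_pred G Q"
proof -
  obtain p c where "wf_formula (funs G) (rels G) p" "range c \<subseteq> carrier G"
    "\<forall>e. range e \<subseteq> carrier G \<longrightarrow> P e = satisfies G (interleave e c) p"
    using assms(1) unfolding definable_pred_def by blast
  then show ?thesis
    unfolding definable_pred_def using assms(2) by (intro exI[of _ p] exI[of _ c]) simp
qed

lemma definable_pred_not:
  assumes "definable_pred G P"
  shows "definable_pred G (\<lambda>e. \<not> P e)"
proof -
  obtain p c where "wf_formula (funs G) (rels G) p" "range c \<subseteq> carrier G"
    "\<forall>e. range e \<subseteq> carrier G \<longrightarrow> P e = satisfies G (interleave e c) p"
    using assms unfolding definable_pred_def by blast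
  then show ?thesis
    unfolding definable_pred_def by (intro exI[of _ "FNot p"] exI[of _ c]) simp
qed

lemma definable_pred_and:
  assumes "definable_pred G P" "definable_pred G Q"
  shows "definable_pred G (\<lambda>e. P e \<and> Q e)"
proof -
  obtain p c where p: "wf_formula (funs G) (rels G) p" "range c \<subseteq> carrier G"
    "\<forall>e. range e \<subseteq> carrier G \<longrightarrow> P e = satisfies G (interleave e c) p"
    using assms(1) unfolding definable_pred_def by blast
  obtain q d where q: "wf_formula (funs G) (rels G) q" "range d \<subseteq> carrier G"
    "\<forall>e. range e \<subseteq> carrier G \<longrightarrow> Q e = satisfies G (interleave e d) q"
    using assms(2) unfolding definable_pred_def by blast
  show ?thesis
    unfolding definable_pred_def
    using p q
    by (intro exI[of _ "FAnd (rename_formula shift1 p) (rename_formula shift2 q)"]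
          exI[of _ "interleave c d"])
      (simp add: wf_rename_formula satisfies_rename inj_shift interleave_shift range_interleave)
qed

lemma definable_pred_ex:
  assumes "definable_pred G P"
  shows "definable_pred G (\<lambda>e. \<exists>a\<in>carrier G. P (e(v := a)))"
proof -
  obtain p c where p: "wf_formula (funs G) (rels G) p" "range c \<subseteq> carrier G"
    "\<forall>e. range e \<subseteq> carrier G \<longrightarrow> P e = satisfies G (interleave e c) p"
    using assms(1) unfolding definable_pred_def by blast
  have "range (e(v := a)) \<subseteq> carrier G" if "range e \<subseteq> carrier G" "a \<in> carrier G" for e a
    using that by auto
  then show ?thesis
    unfolding definable_pred_def using p
    \<comment> \<open>Argument \<open>v\<close> is variable \<open>2 * v\<close> of the formula, as
      arguments occupy the even places.\<close>
    by (intro exI[of _ "FEx (2 * v) p"] exI[of _ c]) (simp add: interleave_upd)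
qed

lemma definable_pred_imp:
  "definable_pred G P \<Longrightarrow> definable_pred G Q \<Longrightarrow> definable_pred G (\<lambda>e. P e \<longrightarrow> Q e)"
  using definable_pred_not[OF definable_pred_and[OF _ definable_pred_not], of G P Q]
  by (rule definable_pred_cong) auto

lemma definable_pred_or:
  "definable_pred G P \<Longrightarrow> definable_pred G Q \<Longrightarrow> definable_pred G (\<lambda>e. P e \<or> Q e)"
  using definable_pred_imp[OF definable_pred_not, of G P Q]
  by (rule definable_pred_cong) auto

lemma definable_pred_all:
  "definable_pred G P \<Longrightarrow> definable_pred G (\<lambda>e. \<forall>a\<in>carrier G. P (e(v := a)))"
  using definable_pred_not[OF definable_pred_ex[OF definable_pred_not], of G P v]
  by (rule definable_pred_cong) auto

lemma definable_fun_var: "monoid G \<Longrightarrow> definable_fun G (\<lambda>e. e v)"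
  unfolding definable_fun_def
  by (intro exI[of _ "TVar (2 * v)"] exI[of _ "\<lambda>_. \<one>\<^bsub>G\<^esub>"]) (auto simp: interleave_def monoid.one_closed)

lemma definable_fun_const: "g \<in> carrier G \<Longrightarrow> definable_fun G (\<lambda>_. g)"
  unfolding definable_fun_def
  \<comment> \<open>Variable 1 is the first parameter place.\<close>
  by (intro exI[of _ "TVar 1"] exI[of _ "\<lambda>_. g"]) (auto simp: interleave_def)

lemma definable_fun_mult:
  assumes "definable_fun G f" "definable_fun G g"
  shows "definable_fun G (\<lambda>e. f e \<otimes>\<^bsub>G\<^esub> g e)"
proof -
  obtain s c where s: "wf_term (funs G) s" "range c \<subseteq> carrier G"
    "\<forall>e. range e \<subseteq> carrier G \<longrightarrow> f e = term_val G (interleave e c) s"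
    using assms(1) unfolding definable_fun_def by blast
  obtain t d where t: "wf_term (funs G) t" "range d \<subseteq> carrier G"
    "\<forall>e. range e \<subseteq> carrier G \<longrightarrow> g e = term_val G (interleave e d) t"
    using assms(2) unfolding definable_fun_def by blast
  show ?thesis
    unfolding definable_fun_def using s t
    by (intro exI[of _ "TMult (rename_term shift1 s) (rename_term shift2 t)"]
          exI[of _ "interleave c d"])
      (simp add: wf_rename_term term_val_rename interleave_shift range_interleave)
qed

lemma definable_fun_inv:
  assumes "definable_fun G f"
  shows "definable_fun G (\<lambda>e. inv\<^bsub>G\<^esub> (f e))"
proof -
  obtain s c where s: "wf_term (funs G) s" "range c \<subseteq> carrier G"
    "\<forall>e. range e \<subseteq> carrier G \<longrightarrow> f e = term_val G (interleave e c) s"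
    using assms(1) unfolding definable_fun_def by blast
  then show ?thesis
    unfolding definable_fun_def by (intro exI[of _ "TInv s"] exI[of _ c]) simp
qed

lemma definable_pred_eq:
  assumes "definable_fun G f" "definable_fun G g"
  shows "definable_pred G (\<lambda>e. f e = g e)"
proof -
  obtain s c where s: "wf_term (funs G) s" "range c \<subseteq> carrier G"
    "\<forall>e. range e \<subseteq> carrier G \<longrightarrow> f e = term_val G (interleave e c) s"
    using assms(1) unfolding definable_fun_def by blast
  obtain t d where t: "wf_term (funs G) t" "range d \<subseteq> carrier G"
    "\<forall>e. range e \<subseteq> carrier G \<longrightarrow> g e = term_val G (interleave e d) t"
    using assms(2) unfolding definable_fun_def by blast
  show ?thesis
    unfolding definable_pred_def using s t
    by (intro exI[of _ "FEq (rename_term shift1 s) (rename_term shift2 t)"]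
          exI[of _ "interleave c d"])
      (simp add: wf_rename_term term_val_rename interleave_shift range_interleave)
qed

lemma definable_pred_True: "monoid G \<Longrightarrow> definable_pred G (\<lambda>_. True)"
  using definable_pred_eq[OF definable_fun_var definable_fun_var, of G 0 0] by simp

lemma definable_pred_False: "monoid G \<Longrightarrow> definable_pred G (\<lambda>_. False)"
  using definable_pred_not[OF definable_pred_True, of G] by simp

lemma definable_pred_ball:
  assumes "monoid G" "finite I" "\<And>i. i \<in> I \<Longrightarrow> definable_pred G (P i)"
  shows "definable_pred G (\<lambda>e. \<forall>i\<in>I. P i e)"
  using assms(2,3)
  by (induction I rule: finite_induct) (simp_all add: definable_pred_True assms(1) definable_pred_and)

lemma definable_pred_bex:
  assumes "monoid G" "finite I" "\<And>i. i \<in> I \<Longrightarrow> definable_pred G (P i)"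
  shows "definable_pred G (\<lambda>e. \<exists>i\<in>I. P i e)"
  using assms(2,3)
  by (induction I rule: finite_induct) (simp_all add: definable_pred_False assms(1) definable_pred_or)

text \<open>A block of \<open>m\<close> existential quantifiers over the variables from
  \<open>k\<close> on, used to quantify over coset representatives. The tuple is encoded as a
  sequence, so no type of tuples of varying length is involved.\<close>

lemma definable_pred_ex_tuple:
  fixes G :: "('a, 'f, 'r) group_structure"
  assumes "definable_pred G P"
  shows "definable_pred G (\<lambda>e. \<exists>y. range y \<subseteq> carrier G \<and>
           P (\<lambda>v. if k \<le> v \<and> v < k + m then y v else e v))"
  using assms
proof (induction m arbitrary: P)
  case 0
  show ?case
  proof (rule definable_pred_cong[OF 0])
    fix e :: "nat \<Rightarrow> 'a" assume "range e \<subseteq> carrier G"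
    moreover have "(\<lambda>v. if k \<le> v \<and> v < k then y v else e v) = e" for y by (rule ext) auto
    ultimately show "P e = (\<exists>y. range y \<subseteq> carrier G \<and> P (\<lambda>v. if k \<le> v \<and> v < k + 0 then y v else e v))"
      by auto
  qed
next
  case (Suc m)
  show ?case
  \<comment> \<open>The last variable of the block is quantified innermost, and the induction
    hypothesis quantifies the others.\<close>
  proof (rule definable_pred_cong[OF Suc.IH[OF definable_pred_ex[OF Suc.prems, of "k + m"]]])
    fix e :: "nat \<Rightarrow> 'a"
    show "(\<exists>y. range y \<subseteq> carrier G \<and>
        (\<exists>a\<in>carrier G. P ((\<lambda>v. if k \<le> v \<and> v < k + m then y v else e v)(k + m := a)))) =
      (\<exists>y. range y \<subseteq> carrier G \<and> P (\<lambda>v. if k \<le> v \<and> v < k + Suc m then y v else e v))"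
      (is "?L = ?R")
    proof
      assume ?L
      then obtain y a where y: "range y \<subseteq> carrier G" "a \<in> carrier G"
        "P ((\<lambda>v. if k \<le> v \<and> v < k + m then y v else e v)(k + m := a))"
        by (elim exE conjE bexE) (rule that)
      have "(\<lambda>v. if k \<le> v \<and> v < k + m then y v else e v)(k + m := a) =
        (\<lambda>v. if k \<le> v \<and> v < k + Suc m then (y(k + m := a)) v else e v)" by auto
      then show ?R using y by (intro exI[of _ "y(k + m := a)"]) auto
    next
      assume ?R
      then obtain y where y: "range y \<subseteq> carrier G"
        "P (\<lambda>v. if k \<le> v \<and> v < k + Suc m then y v else e v)"
        by (elim exE conjE) (rule that)
      have "(\<lambda>v. if k \<le> v \<and> v < k + m then y v else e v)(k + m := y (k + m)) =
        (\<lambda>v. if k \<le> v \<and> v < k + Suc m then y v else e v)" by auto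
      then show ?L using y by (intro exI[of _ y] conjI bexI[of _ "y (k + m)"]) auto
    qed
  qed
qed

section \<open>Passing between definable sets and definable predicates\<close>

lemma definable_pred_var:
  assumes "definable G A"
  shows "definable_pred G (\<lambda>e. e v \<in> A)"
proof -
  obtain p e0 where p: "wf_formula (funs G) (rels G) p" "\<forall>v. e0 v \<in> carrier G"
    "A = {x \<in> carrier G. satisfies G (e0(0 := x)) p}"
    using assms unfolding definable_def by blast
  \<comment> \<open>The free variable 0 of the defining formula becomes argument \<open>v\<close>,
    and every other variable becomes the parameter of the same index.\<close>
  define h where "h = (\<lambda>u::nat. if u = 0 then 2 * v else 2 * u + 1)"
  have "2 * v \<noteq> Suc (2 * u)" "Suc (2 * u) \<noteq> 2 * v" for u by presburger+
  then have h: "inj h" unfolding inj_def h_def by auto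
  have "(\<lambda>u. interleave e e0 (h u)) = e0(0 := e v)" for e
    by (auto simp: fun_eq_iff interleave_def h_def)
  then show ?thesis
    unfolding definable_pred_def using p h
    by (intro exI[of _ "rename_formula h p"] exI[of _ e0])
      (auto simp: wf_rename_formula satisfies_rename)
qed

text \<open>Membership of a term is expressed without substitution: some value of the fresh variable
  \<open>v\<close> equals \<open>f e\<close> and lies in \<open>A\<close>.\<close>

lemma definable_pred_mem:
  assumes "definable G A" "definable_fun G f" "monoid G"
    and fresh: "\<And>e a. f (e(v := a)) = f e"
    and closed: "\<And>e. (\<And>v. e v \<in> carrier G) \<Longrightarrow> f e \<in> carrier G"
  shows "definable_pred G (\<lambda>e. f e \<in> A)"
  using definable_pred_ex[OF definable_pred_and[OF
        definable_pred_eq[OF definable_fun_var[OF assms(3), of v] assms(2)]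
        definable_pred_var[OF assms(1), of v]], of v]
  by (rule definable_pred_cong) (use closed in \<open>auto simp: fresh range_subsetD\<close>)


lemma definableI:
  assumes "definable_pred G (\<lambda>e. P (e 0))" "monoid G"
  shows "definable G {x \<in> carrier G. P x}"
proof -
  obtain p c where p: "wf_formula (funs G) (rels G) p" "range c \<subseteq> carrier G"
    "\<forall>e. range e \<subseteq> carrier G \<longrightarrow> P (e 0) = satisfies G (interleave e c) p"
    using assms(1) unfolding definable_def definable_pred_def by blast
  \<comment> \<open>The predicate reads argument 0 alone, so the remaining arguments can be filled
    with \<open>\<one>\<close>.\<close>
  let ?e = "interleave (\<lambda>_. \<one>\<^bsub>G\<^esub>) c"
  have e: "?e(0 := x) = interleave ((\<lambda>_. \<one>\<^bsub>G\<^esub>)(0 := x)) c" for x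
    using interleave_upd[of "\<lambda>_. \<one>\<^bsub>G\<^esub>" c 0 x] by simp
  have 1: "\<one>\<^bsub>G\<^esub> \<in> carrier G" using assms(2) by (rule monoid.one_closed)
  have "P x = satisfies G (?e(0 := x)) p" if x: "x \<in> carrier G" for x
  proof -
    have r: "range ((\<lambda>_::nat. \<one>\<^bsub>G\<^esub>)(0 := x)) \<subseteq> carrier G" using 1 x by (auto split: if_splits)
    have "P (((\<lambda>_::nat. \<one>\<^bsub>G\<^esub>)(0 := x)) 0) = satisfies G (?e(0 := x)) p"
      unfolding e by (rule p(3)[rule_format, OF r])
    then show ?thesis by simp
  qed
  moreover have "\<forall>v. ?e v \<in> carrier G" using p(2) 1 by (auto simp: interleave_def)
  ultimately show ?thesis unfolding definable_def using p(1) by (intro exI[of _ p] exI[of _ ?e]) auto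
qed

lemma definable_Int:
  assumes "monoid G" "definable G A" "definable G B" "A \<subseteq> carrier G"
  shows "definable G (A \<inter> B)"
proof -
  have "definable G {x \<in> carrier G. x \<in> A \<and> x \<in> B}"
    by (intro definableI definable_pred_and definable_pred_var assms)
  moreover have "{x \<in> carrier G. x \<in> A \<and> x \<in> B} = A \<inter> B" using assms(4) by auto
  ultimately show ?thesis by simp
qed

section \<open>Subquotients\<close>

lemma (in group) index_le_of_card_rcosets:
  assumes "E \<subseteq> carrier G" "C \<subseteq> carrier G" "\<one> \<in> C"
    "finite_index (G\<lparr>carrier := E\<rparr>) C" "card (rcosets\<^bsub>G\<lparr>carrier := E\<rparr>\<^esub> C) \<le> d"
  shows "index_le G E C d"
proof -
  have R: "rcosets\<^bsub>G\<lparr>carrier := E\<rparr>\<^esub> C = (\<lambda>a. C #> a) ` E"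
    unfolding RCOSETS_def by auto
  define rep where "rep = inv_into E (\<lambda>a. C #> a)"
  let ?T = "rep ` (\<lambda>a. C #> a) ` E"
  have rep: "rep (C #> a) \<in> E" "C #> rep (C #> a) = C #> a" if "a \<in> E" for a
    unfolding rep_def using that by (simp_all add: inv_into_into f_inv_into_f)
  have "finite ((\<lambda>a. C #> a) ` E)" using assms(4) R unfolding finite_index_def by simp
  then have "finite ?T" "card ?T \<le> d"
    using card_image_le[of "(\<lambda>a. C #> a) ` E" rep] assms(5) R by auto
  moreover have "?T \<subseteq> carrier G" using rep(1) assms(1) by blast
  moreover have "\<exists>t\<in>?T. x \<otimes> inv t \<in> C" if x: "x \<in> E" for x
  proof -
    let ?t = "rep (C #> x)"
    have G: "x \<in> carrier G" "?t \<in> carrier G" using x rep(1)[OF x] assms(1) by auto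
    have "x \<in> C #> x" unfolding r_coset_def using assms(3) G(1) by force
    then have "x \<in> C #> ?t" using rep(2)[OF x] by simp
    then obtain c where "c \<in> C" "x = c \<otimes> ?t" unfolding r_coset_def by auto
    then have "x \<otimes> inv ?t \<in> C" using G assms(2) mult_inv_eq_conv by blast
    then show ?thesis using x by blast
  qed
  ultimately show ?thesis unfolding index_le_def by blast
qed

lemma (in group) finite_index_of_almost_contained:
  assumes "almost_contained G H D" "subgroup H G" "subgroup D G"
  shows "finite_index (G\<lparr>carrier := H\<rparr>) (H \<inter> D)"
proof -
  have HG: "H \<subseteq> carrier G" using assms(2) by (simp add: subgroup.subset)
  have HD: "subgroup (H \<inter> D) G" by (intro subgroups_Inter_pair assms)
  have "almost_contained G H (H \<inter> D)"
    using almost_contained_Int[OF almost_contained_subset[OF assms(2)] assms(1)] HG assms by blast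
  then obtain T where T: "T \<subseteq> carrier G" "finite T" "\<And>x. x \<in> H \<Longrightarrow> \<exists>t\<in>T. x \<otimes> inv t \<in> H \<inter> D"
    by (rule almost_containedE) blast
  \<comment> \<open>Representatives may be any elements of the group; it is enough that the cosets
    of elements of \<open>H\<close> are among the finitely many cosets of elements of
    \<open>T\<close>.\<close>
  have "(\<lambda>a. (H \<inter> D) #> a) ` H \<subseteq> (\<lambda>t. (H \<inter> D) #> t) ` T"
  proof clarify
    fix x assume x: "x \<in> H"
    then obtain t where t: "t \<in> T" "x \<otimes> inv t \<in> H \<inter> D" using T(3) by blast
    have G: "x \<in> carrier G" "t \<in> carrier G" using x t T HG by auto
    have "(H \<inter> D) #> (x \<otimes> inv t) = H \<inter> D"
      by (rule coset_join2[OF _ HD t(2)]) (use G in simp)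
    then have "(H \<inter> D) #> x = (H \<inter> D) #> t"
      by (rule coset_mult_inv1) (use G HD subgroup.subset in auto)
    then show "(H \<inter> D) #> x \<in> (\<lambda>t. (H \<inter> D) #> t) ` T" using t by blast
  qed
  then have "finite ((\<lambda>a. (H \<inter> D) #> a) ` H)" using T(2) finite_subset by blast
  moreover have "rcosets\<^bsub>G\<lparr>carrier := H\<rparr>\<^esub> (H \<inter> D) = (\<lambda>a. (H \<inter> D) #> a) ` H"
    unfolding RCOSETS_def by auto
  ultimately show ?thesis unfolding finite_index_def by simp
qed

section \<open>The quotient of \<open>K\<close> by \<open>N\<close> in terms of
  representatives\<close>

locale subquotient = group G for G (structure) +
  fixes K N
  assumes subgroup_K: "subgroup K G" and normal_N: "N \<lhd> G\<lparr>carrier := K\<rparr>"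
begin

text \<open>The elements of \<open>Q\<close> are cosets, whereas definability concerns subsets of
  \<open>carrier G\<close>. Statements about \<open>Q\<close> are therefore translated into
  statements about representatives in \<open>K\<close> and membership in \<open>N\<close>.\<close>

abbreviation Q where "Q \<equiv> (G\<lparr>carrier := K\<rparr>) Mod N"

sublocale Q: group Q
  by (rule normal.factorgroup_is_group[OF normal_N])

lemma K_closed: "x \<in> K \<Longrightarrow> x \<in> carrier G" "\<one> \<in> K" "x \<in> K \<Longrightarrow> inv x \<in> K"
  "x \<in> K \<Longrightarrow> y \<in> K \<Longrightarrow> x \<otimes> y \<in> K"
  using subgroup_K by (auto simp: subgroup_def)

lemma subgroup_N: "subgroup N G" and N_subset_K: "N \<subseteq> K"
proof -
  have "subgroup N (G\<lparr>carrier := K\<rparr>)" by (rule normal_imp_subgroup[OF normal_N])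
  then show "subgroup N G" using incl_subgroup[OF subgroup_K] by blast
  show "N \<subseteq> K" using subgroup.subset[OF \<open>subgroup N (G\<lparr>carrier := K\<rparr>)\<close>] by simp
qed

lemma carrier_Q: "carrier Q = (\<lambda>x. N #> x) ` K"
  unfolding carrier_FactGroup by simp

lemma proj_closed: "x \<in> K \<Longrightarrow> N #> x \<in> carrier Q"
  unfolding carrier_Q by blast

lemma proj_mult: "x \<in> K \<Longrightarrow> y \<in> K \<Longrightarrow> (N #> x) \<otimes>\<^bsub>Q\<^esub> (N #> y) = N #> (x \<otimes> y)"
  using normal.rcos_sum[OF normal_N, of x y] by simp

lemma proj_inv: "x \<in> K \<Longrightarrow> inv\<^bsub>Q\<^esub> (N #> x) = N #> inv x"
proof (rule Q.inv_equality)
  assume x: "x \<in> K"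
  have "N #> \<one> = N" using subgroup_N by (simp add: subgroup.subset)
  then show "(N #> inv x) \<otimes>\<^bsub>Q\<^esub> (N #> x) = \<one>\<^bsub>Q\<^esub>"
    using x K_closed by (simp add: proj_mult del: mult_FactGroup)
qed (simp_all only: proj_closed K_closed)

lemma proj_eq_iff: "x \<in> K \<Longrightarrow> y \<in> K \<Longrightarrow> N #> x = N #> y \<longleftrightarrow> x \<otimes> inv y \<in> N"
proof
  assume xy: "x \<in> K" "y \<in> K"
  have NG: "N \<subseteq> carrier G" using subgroup_N by (simp add: subgroup.subset)
  {
    assume "N #> x = N #> y"
    then have "N #> (x \<otimes> inv y) = N" using coset_mult_inv2 xy K_closed NG by simp
    then show "x \<otimes> inv y \<in> N" using coset_join1 subgroup_N xy K_closed by simp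
  next
    assume "x \<otimes> inv y \<in> N"
    then have "N #> (x \<otimes> inv y) = N" using coset_join2 subgroup_N xy K_closed by simp
    then show "N #> x = N #> y" using coset_mult_inv1 xy K_closed NG by simp
  }
qed

lemma proj_mem_centralizer_iff:
  assumes "x \<in> K" "y \<in> K"
  shows "N #> x \<in> centralizer Q {N #> y} \<longleftrightarrow> x \<otimes> y \<otimes> inv x \<otimes> inv y \<in> N"
proof -
  have "N #> x \<in> centralizer Q {N #> y} \<longleftrightarrow> N #> (x \<otimes> y) = N #> (y \<otimes> x)"
    using assms proj_closed proj_mult by (simp add: centralizer_def del: mult_FactGroup)
  also have "\<dots> \<longleftrightarrow> x \<otimes> y \<otimes> inv (y \<otimes> x) \<in> N"
    using assms K_closed by (intro proj_eq_iff) auto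
  also have "x \<otimes> y \<otimes> inv (y \<otimes> x) = x \<otimes> y \<otimes> inv x \<otimes> inv y"
    using assms K_closed by (simp add: inv_mult_group m_assoc)
  finally show ?thesis .
qed

lemma subgroup_proj_image:
  assumes "subgroup A G" "A \<subseteq> K"
  shows "subgroup ((\<lambda>x. N #> x) ` A) Q"
proof (rule Q.subgroupI)
  show "(\<lambda>x. N #> x) ` A \<subseteq> carrier Q" using assms(2) proj_closed by blast
  show "(\<lambda>x. N #> x) ` A \<noteq> {}" using subgroup.one_closed[OF assms(1)] by blast
  fix a assume "a \<in> (\<lambda>x. N #> x) ` A"
  then obtain x where x: "x \<in> A" "a = N #> x" by blast
  then show "inv\<^bsub>Q\<^esub> a \<in> (\<lambda>x. N #> x) ` A"
    using assms proj_inv[of x] subgroup.m_inv_closed[OF assms(1)] by auto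
  fix b assume "b \<in> (\<lambda>x. N #> x) ` A"
  then obtain y where y: "y \<in> A" "b = N #> y" by blast
  then have "a \<otimes>\<^bsub>Q\<^esub> b = N #> (x \<otimes> y)" using x assms(2) proj_mult by blast
  then show "a \<otimes>\<^bsub>Q\<^esub> b \<in> (\<lambda>x. N #> x) ` A"
    using subgroup.m_closed[OF assms(1) x(1) y(1)] by blast
qed

lemma subgroup_proj_vimage:
  assumes "subgroup B Q"
  shows "subgroup {x \<in> K. N #> x \<in> B} G"
proof (rule subgroupI)
  show "{x \<in> K. N #> x \<in> B} \<subseteq> carrier G" using K_closed by blast
  have "N #> \<one> = \<one>\<^bsub>Q\<^esub>" using subgroup_N by (simp add: subgroup.subset)
  then have "\<one> \<in> {x \<in> K. N #> x \<in> B}"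
    using K_closed(2) subgroup.one_closed[OF assms] by (metis (mono_tags) mem_Collect_eq)
  then show "{x \<in> K. N #> x \<in> B} \<noteq> {}" by blast
  fix a assume a: "a \<in> {x \<in> K. N #> x \<in> B}"
  then show "inv a \<in> {x \<in> K. N #> x \<in> B}"
    using subgroup.m_inv_closed[OF assms, of "N #> a"] proj_inv K_closed by simp
  fix b assume b: "b \<in> {x \<in> K. N #> x \<in> B}"
  then show "a \<otimes> b \<in> {x \<in> K. N #> x \<in> B}"
    using a subgroup.m_closed[OF assms, of "N #> a" "N #> b"] proj_mult K_closed
    by (simp del: mult_FactGroup)
qed

lemma proj_commutator:
  assumes "x \<in> K" "y \<in> K"
  shows "(N #> x) \<otimes>\<^bsub>Q\<^esub> (N #> y) \<otimes>\<^bsub>Q\<^esub> inv\<^bsub>Q\<^esub> (N #> x) \<otimes>\<^bsub>Q\<^esub> inv\<^bsub>Q\<^esub> (N #> y) =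
    N #> (x \<otimes> y \<otimes> inv x \<otimes> inv y)"
  using assms K_closed by (simp add: proj_mult proj_inv del: mult_FactGroup)

text \<open>Finitely many representatives in the quotient lift to finitely many in \<open>K\<close>,
  and conversely.\<close>

lemma almost_contained_proj_iff:
  assumes "A \<subseteq> K" "B \<subseteq> carrier Q"
  shows "almost_contained Q ((\<lambda>x. N #> x) ` A) B \<longleftrightarrow>
    (\<exists>T \<subseteq> K. finite T \<and> (\<forall>a\<in>A. \<exists>t\<in>T. N #> (a \<otimes> inv t) \<in> B))"
proof
  assume "almost_contained Q ((\<lambda>x. N #> x) ` A) B"
  then obtain T where T: "T \<subseteq> carrier Q" "finite T"
    "\<And>x. x \<in> (\<lambda>x. N #> x) ` A \<Longrightarrow> \<exists>t\<in>T. x \<otimes>\<^bsub>Q\<^esub> inv\<^bsub>Q\<^esub> t \<in> B"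
    by (rule almost_containedE) blast
  obtain U where U: "U \<subseteq> K" "finite U" "T = (\<lambda>x. N #> x) ` U"
    using finite_subset_image[OF T(2)] T(1) unfolding carrier_Q by blast
  have "\<exists>t\<in>U. N #> (a \<otimes> inv t) \<in> B" if a: "a \<in> A" for a
  proof -
    obtain t where t: "t \<in> U" "(N #> a) \<otimes>\<^bsub>Q\<^esub> inv\<^bsub>Q\<^esub> (N #> t) \<in> B"
      using T(3) a U(3) by blast
    have aK: "a \<in> K" "t \<in> K" using a t assms(1) U(1) by auto
    then have "(N #> a) \<otimes>\<^bsub>Q\<^esub> inv\<^bsub>Q\<^esub> (N #> t) = N #> (a \<otimes> inv t)"
      by (simp add: proj_inv proj_mult K_closed del: mult_FactGroup)
    then show ?thesis using t by metis
  qed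
  then show "\<exists>T \<subseteq> K. finite T \<and> (\<forall>a\<in>A. \<exists>t\<in>T. N #> (a \<otimes> inv t) \<in> B)" using U(1,2) by blast
next
  assume "\<exists>T \<subseteq> K. finite T \<and> (\<forall>a\<in>A. \<exists>t\<in>T. N #> (a \<otimes> inv t) \<in> B)"
  then obtain T where T: "T \<subseteq> K" "finite T" "\<And>a. a \<in> A \<Longrightarrow> \<exists>t\<in>T. N #> (a \<otimes> inv t) \<in> B" by blast
  show "almost_contained Q ((\<lambda>x. N #> x) ` A) B"
  proof (rule almost_containedI)
    show "(\<lambda>x. N #> x) ` T \<subseteq> carrier Q" "finite ((\<lambda>x. N #> x) ` T)" using T proj_closed by auto
    fix x assume "x \<in> (\<lambda>x. N #> x) ` A"
    then obtain a where a: "a \<in> A" "x = N #> a" by blast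
    obtain t where t: "t \<in> T" "N #> (a \<otimes> inv t) \<in> B" using T(3)[OF a(1)] by blast
    have aK: "a \<in> K" "t \<in> K" using a t assms(1) T(1) by auto
    then have "(N #> a) \<otimes>\<^bsub>Q\<^esub> inv\<^bsub>Q\<^esub> (N #> t) = N #> (a \<otimes> inv t)"
      by (simp add: proj_inv proj_mult K_closed del: mult_FactGroup)
    then have "x \<otimes>\<^bsub>Q\<^esub> inv\<^bsub>Q\<^esub> (N #> t) \<in> B" using a(2) t(2) by metis
    then show "\<exists>t\<in>(\<lambda>x. N #> x) ` T. x \<otimes>\<^bsub>Q\<^esub> inv\<^bsub>Q\<^esub> t \<in> B" using t(1) by blast
  qed
qed

text \<open>The right-hand side speaks of at most \<open>m\<close> elements and of membership in
  \<open>K\<close>, \<open>N\<close> and the preimage of \<open>B\<close>, so that a first-order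
  formula can express it.\<close>

lemma index_le_centralizer_proj_iff:
  assumes "x \<in> K" "B \<subseteq> carrier Q"
  shows "index_le Q B (centralizer Q {N #> x}) m \<longleftrightarrow>
    (\<exists>y. range y \<subseteq> carrier G \<and> (\<forall>z\<in>K. N #> z \<in> B \<longrightarrow>
      (\<exists>i\<in>{..<m::nat}. y i \<in> K \<and>
        (z \<otimes> inv (y i)) \<otimes> x \<otimes> inv (z \<otimes> inv (y i)) \<otimes> inv x \<in> N)))"
    (is "?L \<longleftrightarrow> ?R")
proof
  have key: "(N #> z) \<otimes>\<^bsub>Q\<^esub> inv\<^bsub>Q\<^esub> (N #> t) \<in> centralizer Q {N #> x} \<longleftrightarrow>
      (z \<otimes> inv t) \<otimes> x \<otimes> inv (z \<otimes> inv t) \<otimes> inv x \<in> N" if "z \<in> K" "t \<in> K" for z t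
  proof -
    have "(N #> z) \<otimes>\<^bsub>Q\<^esub> inv\<^bsub>Q\<^esub> (N #> t) = N #> (z \<otimes> inv t)"
      using that by (simp add: proj_inv proj_mult K_closed del: mult_FactGroup)
    then show ?thesis
      using proj_mem_centralizer_iff[of "z \<otimes> inv t" x] that assms(1) K_closed by metis
  qed
  {
    assume ?L
    then obtain T where T: "T \<subseteq> carrier Q" "finite T" "card T \<le> m"
      "\<And>b. b \<in> B \<Longrightarrow> \<exists>t\<in>T. b \<otimes>\<^bsub>Q\<^esub> inv\<^bsub>Q\<^esub> t \<in> centralizer Q {N #> x}"
      unfolding index_le_def by blast
    obtain g where g: "bij_betw g {0..<card T} T" using ex_bij_betw_nat_finite[OF T(2)] by blast
    \<comment> \<open>The representatives may be fewer than \<open>m\<close>; the sequence is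
      continued by \<open>\<one>\<close>.\<close>
    define y where "y = (\<lambda>i. if i < card T then SOME t. t \<in> K \<and> N #> t = g i else \<one>)"
    have y: "y i \<in> K \<and> N #> y i = g i" if "i < card T" for i
    proof -
      have "g i \<in> T" using g that by (auto simp: bij_betw_def)
      then have "\<exists>t. t \<in> K \<and> N #> t = g i" using T(1) unfolding carrier_Q by blast
      then show ?thesis unfolding y_def using that someI_ex[of "\<lambda>t. t \<in> K \<and> N #> t = g i"] by simp
    qed
    have yG: "range y \<subseteq> carrier G"
    proof clarify
      fix i show "y i \<in> carrier G" using y[of i] K_closed unfolding y_def by (cases "i < card T") auto
    qed
    moreover have "\<exists>i\<in>{..<m}. y i \<in> K \<and>
        (z \<otimes> inv (y i)) \<otimes> x \<otimes> inv (z \<otimes> inv (y i)) \<otimes> inv x \<in> N" if z: "z \<in> K" "N #> z \<in> B" for z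
    proof -
      obtain t where t: "t \<in> T" "(N #> z) \<otimes>\<^bsub>Q\<^esub> inv\<^bsub>Q\<^esub> t \<in> centralizer Q {N #> x}"
        using T(4)[OF z(2)] by blast
      have "t \<in> g ` {0..<card T}" using t(1) bij_betw_imp_surj_on[OF g] by simp
      then obtain i where i: "i < card T" "t = g i" by auto
      have "(N #> z) \<otimes>\<^bsub>Q\<^esub> inv\<^bsub>Q\<^esub> (N #> y i) \<in> centralizer Q {N #> x}" using t(2) i y by metis
      then show ?thesis using key[OF z(1), of "y i"] y[OF i(1)] i T(3) by auto
    qed
    ultimately show ?R by blast
  next
    assume ?R
    then obtain y where y: "\<forall>z\<in>K. N #> z \<in> B \<longrightarrow> (\<exists>i\<in>{..<m}. y i \<in> K \<and>
        (z \<otimes> inv (y i)) \<otimes> x \<otimes> inv (z \<otimes> inv (y i)) \<otimes> inv x \<in> N)"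
      by (elim exE conjE) (rule that)
    \<comment> \<open>Only the entries of the sequence lying in \<open>K\<close> have a coset in the
      quotient.\<close>
    define I where "I = {i \<in> {..<m}. y i \<in> K}"
    have I: "finite I" "card I \<le> m"
      using card_mono[of "{..<m}" I] unfolding I_def by auto
    have "\<exists>t\<in>(\<lambda>i. N #> y i) ` I. b \<otimes>\<^bsub>Q\<^esub> inv\<^bsub>Q\<^esub> t \<in> centralizer Q {N #> x}" if b: "b \<in> B" for b
    proof -
      obtain z where z: "z \<in> K" "b = N #> z" using b assms(2) unfolding carrier_Q by blast
      then obtain i where "i < m" "y i \<in> K"
        "(z \<otimes> inv (y i)) \<otimes> x \<otimes> inv (z \<otimes> inv (y i)) \<otimes> inv x \<in> N" using y b by blast
      then show ?thesis using key[OF z(1), of "y i"] z(2) unfolding I_def by blast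
    qed
    moreover have "(\<lambda>i. N #> y i) ` I \<subseteq> carrier Q" unfolding I_def using proj_closed by blast
    moreover have "card ((\<lambda>i. N #> y i) ` I) \<le> m" using card_image_le[OF I(1)] I(2) le_trans by blast
    ultimately show ?L unfolding index_le_def using I(1) by (intro exI[of _ "(\<lambda>i. N #> y i) ` I"]) simp
  }
qed

text \<open>Again this prepares definability: commuting with a commutator in the quotient becomes
  membership of an iterated commutator of representatives in \<open>N\<close>.\<close>

lemma proj_mem_commutator_centralizer_iff:
  assumes "x \<in> K" "B \<subseteq> carrier Q"
  shows "N #> x \<in> Q.commutator_centralizer B \<longleftrightarrow> N #> x \<in> B \<and>
    (\<forall>y\<in>K. \<forall>z\<in>K. N #> y \<in> B \<longrightarrow> N #> z \<in> B \<longrightarrow>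
      x \<otimes> (y \<otimes> z \<otimes> inv y \<otimes> inv z) \<otimes> inv x \<otimes> inv (y \<otimes> z \<otimes> inv y \<otimes> inv z) \<in> N)"
proof -
  let ?C = "{u \<otimes>\<^bsub>Q\<^esub> v \<otimes>\<^bsub>Q\<^esub> inv\<^bsub>Q\<^esub> u \<otimes>\<^bsub>Q\<^esub> inv\<^bsub>Q\<^esub> v | u v. u \<in> B \<and> v \<in> B}"
  have C: "?C = {N #> (y \<otimes> z \<otimes> inv y \<otimes> inv z) | y z. y \<in> K \<and> z \<in> K \<and> N #> y \<in> B \<and> N #> z \<in> B}"
    (is "_ = ?C'")
  proof
    show "?C \<subseteq> ?C'"
    proof
      fix c assume "c \<in> ?C"
      then obtain u v where uv: "u \<in> B" "v \<in> B" "c = u \<otimes>\<^bsub>Q\<^esub> v \<otimes>\<^bsub>Q\<^esub> inv\<^bsub>Q\<^esub> u \<otimes>\<^bsub>Q\<^esub> inv\<^bsub>Q\<^esub> v" by blast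
      then obtain y z where yz: "y \<in> K" "u = N #> y" "z \<in> K" "v = N #> z"
        using assms(2) unfolding carrier_Q by blast
      then have "c = N #> (y \<otimes> z \<otimes> inv y \<otimes> inv z)" using uv(3) proj_commutator[of y z] by metis
      then show "c \<in> ?C'" using yz uv by blast
    qed
    show "?C' \<subseteq> ?C"
    proof
      fix c assume "c \<in> ?C'"
      then obtain y z where yz: "y \<in> K" "z \<in> K" "N #> y \<in> B" "N #> z \<in> B"
        "c = N #> (y \<otimes> z \<otimes> inv y \<otimes> inv z)" by blast
      then have "c = (N #> y) \<otimes>\<^bsub>Q\<^esub> (N #> z) \<otimes>\<^bsub>Q\<^esub> inv\<^bsub>Q\<^esub> (N #> y) \<otimes>\<^bsub>Q\<^esub> inv\<^bsub>Q\<^esub> (N #> z)"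
        using proj_commutator[of y z] by metis
      then show "c \<in> ?C" using yz by blast
    qed
  qed
  have cent: "g \<in> centralizer Q S \<longleftrightarrow> (\<forall>s\<in>S. g \<in> centralizer Q {s})" if "g \<in> carrier Q" for g S
    using that unfolding centralizer_def by blast
  have all: "(\<forall>s\<in>{f y z | y z. y \<in> K \<and> z \<in> K \<and> R y \<and> R z}. P s) \<longleftrightarrow>
    (\<forall>y\<in>K. \<forall>z\<in>K. R y \<longrightarrow> R z \<longrightarrow> P (f y z))" for f :: "'a \<Rightarrow> 'a \<Rightarrow> 'a set" and R P
    by blast
  have "N #> x \<in> centralizer Q ?C \<longleftrightarrow>
    (\<forall>y\<in>K. \<forall>z\<in>K. N #> y \<in> B \<longrightarrow> N #> z \<in> B \<longrightarrow>
      N #> x \<in> centralizer Q {N #> (y \<otimes> z \<otimes> inv y \<otimes> inv z)})"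
    unfolding C by (subst cent[OF proj_closed[OF assms(1)]]) (rule all)
  also have "\<dots> \<longleftrightarrow> (\<forall>y\<in>K. \<forall>z\<in>K. N #> y \<in> B \<longrightarrow> N #> z \<in> B \<longrightarrow>
      x \<otimes> (y \<otimes> z \<otimes> inv y \<otimes> inv z) \<otimes> inv x \<otimes> inv (y \<otimes> z \<otimes> inv y \<otimes> inv z) \<in> N)"
    using assms(1) K_closed by (simp add: proj_mem_centralizer_iff)
  finally show ?thesis unfolding Q.commutator_centralizer_def by blast
qed

text \<open>The commutators of \<open>Q.commutator_centralizer B\<close> are commutators of elements
  of \<open>B\<close>, hence central in it. Thus the first derived subgroup of the preimage maps
  into the centre, and commutators of its elements lie in \<open>N\<close>.\<close>

lemma derived_derived_subset:
  assumes B: "subgroup B Q"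
  shows "derived G (derived G {x \<in> K. N #> x \<in> Q.commutator_centralizer B}) \<subseteq> N"
proof -
  let ?C = "Q.commutator_centralizer B"
  let ?D = "{x \<in> K. N #> x \<in> ?C}"
  have C: "subgroup ?C Q" by (rule Q.subgroup_commutator_centralizer[OF B])
  have CQ: "?C \<subseteq> carrier Q" by (rule subgroup.subset[OF C])
  let ?Z = "{x \<in> K. N #> x \<in> ?C \<inter> centralizer Q ?C}"
  have "subgroup ?Z G"
    by (intro subgroup_proj_vimage Q.subgroups_Inter_pair C Q.subgroup_centralizer CQ)
  moreover have "derived_set G ?D \<subseteq> ?Z"
  proof
    fix c assume "c \<in> derived_set G ?D"
    then obtain x y where xy: "x \<in> K" "y \<in> K" "N #> x \<in> ?C" "N #> y \<in> ?C" "c = x \<otimes> y \<otimes> inv x \<otimes> inv y"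
      by auto
    have cK: "c \<in> K" unfolding xy(5) using xy(1,2) K_closed by simp
    have c: "N #> c = (N #> x) \<otimes>\<^bsub>Q\<^esub> (N #> y) \<otimes>\<^bsub>Q\<^esub> inv\<^bsub>Q\<^esub> (N #> x) \<otimes>\<^bsub>Q\<^esub> inv\<^bsub>Q\<^esub> (N #> y)"
      unfolding xy(5) using proj_commutator[OF xy(1,2)] by (rule sym)
    have 1: "N #> c \<in> ?C"
      unfolding c using xy C by (intro subgroup.m_closed[OF C] subgroup.m_inv_closed[OF C])
    have "N #> c \<in> {u \<otimes>\<^bsub>Q\<^esub> v \<otimes>\<^bsub>Q\<^esub> inv\<^bsub>Q\<^esub> u \<otimes>\<^bsub>Q\<^esub> inv\<^bsub>Q\<^esub> v | u v. u \<in> B \<and> v \<in> B}"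
      unfolding c using xy unfolding Q.commutator_centralizer_def by blast
    then have "g \<otimes>\<^bsub>Q\<^esub> (N #> c) = (N #> c) \<otimes>\<^bsub>Q\<^esub> g" if "g \<in> ?C" for g
      using that unfolding Q.commutator_centralizer_def centralizer_def by blast
    then have "N #> c \<in> centralizer Q ?C" unfolding centralizer_def using proj_closed[OF cK] by simp
    then show "c \<in> ?Z" using 1 cK by blast
  qed
  ultimately have Z: "derived G ?D \<subseteq> ?Z" unfolding derived_def by (intro generate_subgroup_incl)
  have "derived_set G (derived G ?D) \<subseteq> N"
  proof
    fix c assume "c \<in> derived_set G (derived G ?D)"
    then obtain x y where xy: "x \<in> ?Z" "y \<in> ?Z" "c = x \<otimes> y \<otimes> inv x \<otimes> inv y" using Z by blast
    then have "N #> x \<in> centralizer Q {N #> y}" unfolding centralizer_def by blast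
    then show "c \<in> N" using proj_mem_centralizer_iff xy by blast
  qed
  then show ?thesis unfolding derived_def[of G "derived G ?D"]
    by (intro generate_subgroup_incl subgroup_N)
qed

end

section \<open>Definable envelopes\<close>

text \<open>Among the chains with entries in \<open>A\<close> and large successive indices, one has
  maximal length. Appending a further element of \<open>A\<close> must then give a small index, and
  the centralizer so obtained lies in the centralizer of the new element.\<close>

lemma almost_minimal_centralizers_of_Mc_tilde:
  fixes G :: "('a, 'f, 'r) group_structure" (structure)
  assumes "Mc_tilde G" "subquotient G K N" "definable G K" "definable G N" "K \<subseteq> normalizer G N"
  shows "\<exists>d. group.almost_minimal_centralizers (G\<lparr>carrier := K\<rparr> Mod N) d"
proof -
  interpret subquotient G K N by (rule assms(2))
  have KN: "K \<inter> N = N" using N_subset_K by blast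
  define cent where "cent = (\<lambda>gs. centralizer Q ((\<lambda>g. N #> g) ` set gs))"
  have cent_eq: "quot_centralizer G K N gs = cent gs" for gs
    unfolding quot_centralizer_def cent_def KN ..
  define chain where "chain = (\<lambda>(d::nat) gs. set gs \<subseteq> K \<and> (\<forall>i. Suc i < length gs \<longrightarrow>
     index_at_least (Q\<lparr>carrier := cent (take (Suc i) gs)\<rparr>) (cent (take (Suc (Suc i)) gs)) d))"
  have "\<exists>n0 d. \<forall>gs. chain d gs \<longrightarrow> length gs \<le> n0"
    using assms(1)[unfolded Mc_tilde_def, rule_format, of K N] assms(3-5) subgroup_K subgroup_N
    unfolding KN cent_eq chain_def by blast
  then obtain n0 d where "\<forall>gs. chain d gs \<longrightarrow> length gs \<le> n0" by blast
  then have bound: "length gs \<le> n0" if "chain d gs" for gs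
    using that by blast
  have "\<exists>S \<subseteq> A. finite S \<and> (\<forall>x\<in>A. index_le Q (centralizer Q S) (centralizer Q {x}) d)"
    if A: "A \<subseteq> carrier Q" "A \<noteq> {}" for A
  proof -
    define P where "P = (\<lambda>gs. chain d gs \<and> (\<lambda>g. N #> g) ` set gs \<subseteq> A)"
    have "P []" unfolding P_def chain_def by simp
    then have "\<exists>gs. P gs \<and> (\<forall>hs. P hs \<longrightarrow> length hs \<le> length gs)"
      by (rule ex_has_greatest_nat[where b = "Suc n0"]) (use bound in \<open>auto simp: P_def le_imp_less_Suc\<close>)
    then obtain gs where gs: "P gs" "\<And>hs. P hs \<Longrightarrow> length hs \<le> length gs" by blast
    \<comment> \<open>The chain condition compares nonempty initial segments, so passing from
      \<open>[]\<close> to \<open>[k]\<close> imposes no index condition and a longest chain is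
      nonempty.\<close>
    have ne: "gs \<noteq> []"
    proof
      assume "gs = []"
      obtain k where "k \<in> K" "N #> k \<in> A" using A unfolding carrier_Q by blast
      then have "P [k]" unfolding P_def chain_def by simp
      then show False using gs(2) \<open>gs = []\<close> by fastforce
    qed
    have gsK: "set gs \<subseteq> K" using gs(1) unfolding P_def chain_def by blast
    have "index_le Q (centralizer Q ((\<lambda>g. N #> g) ` set gs)) (centralizer Q {x}) d" if x: "x \<in> A" for x
    proof -
      obtain k where k: "k \<in> K" "x = N #> k" using A x unfolding carrier_Q by blast
      have nP: "\<not> P (gs @ [k])" using gs(2)[of "gs @ [k]"] by auto
      have "\<not> index_at_least (Q\<lparr>carrier := cent gs\<rparr>) (cent (gs @ [k])) d"
      proof
        assume last: "index_at_least (Q\<lparr>carrier := cent gs\<rparr>) (cent (gs @ [k])) d"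
        have "index_at_least (Q\<lparr>carrier := cent (take (Suc i) (gs @ [k]))\<rparr>)
            (cent (take (Suc (Suc i)) (gs @ [k]))) d" if i: "Suc i < length (gs @ [k])" for i
        proof (cases "Suc i = length gs")
          case True
          then show ?thesis using last by simp
        next
          case False
          then have "Suc i < length gs" using i by simp
          moreover have "\<forall>i. Suc i < length gs \<longrightarrow>
             index_at_least (Q\<lparr>carrier := cent (take (Suc i) gs)\<rparr>) (cent (take (Suc (Suc i)) gs)) d"
            using gs(1) unfolding P_def chain_def by blast
          ultimately show ?thesis by simp
        qed
        then have "chain d (gs @ [k])" unfolding chain_def using gsK k(1) by simp
        then have "P (gs @ [k])" using gs(1) k x unfolding P_def by simp
        then show False using nP by blast
      qed
      then have fin: "finite_index (Q\<lparr>carrier := cent gs\<rparr>) (cent (gs @ [k]))"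
        "card (rcosets\<^bsub>Q\<lparr>carrier := cent gs\<rparr>\<^esub> (cent (gs @ [k]))) \<le> d"
        unfolding index_at_least_def by auto
      have gsQ: "(\<lambda>g. N #> g) ` set (gs @ [k]) \<subseteq> carrier Q" using gsK k(1) proj_closed by auto
      have sub: "subgroup (cent (gs @ [k])) Q" unfolding cent_def by (rule Q.subgroup_centralizer[OF gsQ])
      have "index_le Q (cent gs) (cent (gs @ [k])) d"
      proof (rule Q.index_le_of_card_rcosets[OF _ _ _ fin])
        show "cent gs \<subseteq> carrier Q" unfolding cent_def centralizer_def by blast
        show "cent (gs @ [k]) \<subseteq> carrier Q" by (rule subgroup.subset[OF sub])
        show "\<one>\<^bsub>Q\<^esub> \<in> cent (gs @ [k])" by (rule subgroup.one_closed[OF sub])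
      qed
      moreover have "cent (gs @ [k]) \<subseteq> centralizer Q {x}"
        unfolding cent_def k(2) by (rule centralizer_antimono) simp
      ultimately show ?thesis unfolding cent_def using index_le_mono[OF _ subset_refl _ le_refl] by blast
    qed
    moreover have "(\<lambda>g. N #> g) ` set gs \<subseteq> A" using gs(1) unfolding P_def by blast
    ultimately show ?thesis by blast
  qed
  then have "Q.almost_minimal_centralizers d" unfolding Q.almost_minimal_centralizers_def by blast
  then show ?thesis by blast
qed

section \<open>Definability of the groups in the construction\<close>

context group
begin

text \<open>The normalizer is the stabilizer of the set \<open>N\<close> under conjugation. The
  equality of sets is replaced by two conditions on elements, which a formula can state.\<close>

lemma mem_normalizer_iff:
  assumes "subgroup N G"
  shows "g \<in> normalizer G N \<longleftrightarrow>
    g \<in> carrier G \<and> (\<forall>x\<in>N. g \<otimes> x \<otimes> inv g \<in> N \<and> inv g \<otimes> x \<otimes> g \<in> N)"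
proof -
  have NG: "N \<subseteq> carrier G" using assms by (simp add: subgroup.subset)
  have eq: "g <# N #> inv g = (\<lambda>x. g \<otimes> x \<otimes> inv g) ` N"
    unfolding l_coset_def r_coset_def by blast
  have "(\<lambda>x. g \<otimes> x \<otimes> inv g) ` N = N \<longleftrightarrow> (\<forall>x\<in>N. g \<otimes> x \<otimes> inv g \<in> N \<and> inv g \<otimes> x \<otimes> g \<in> N)"
    if g: "g \<in> carrier G"
  proof
    assume im: "(\<lambda>x. g \<otimes> x \<otimes> inv g) ` N = N"
    show "\<forall>x\<in>N. g \<otimes> x \<otimes> inv g \<in> N \<and> inv g \<otimes> x \<otimes> g \<in> N"
    proof
      fix x assume x: "x \<in> N"
      then obtain y where y: "y \<in> N" "x = g \<otimes> y \<otimes> inv g" using im by blast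
      have "inv g \<otimes> x \<otimes> g = y" unfolding y(2) using conj_inv_cancel(2)[OF g] y(1) NG by blast
      then show "g \<otimes> x \<otimes> inv g \<in> N \<and> inv g \<otimes> x \<otimes> g \<in> N" using im x y(1) by blast
    qed
  next
    assume r: "\<forall>x\<in>N. g \<otimes> x \<otimes> inv g \<in> N \<and> inv g \<otimes> x \<otimes> g \<in> N"
    show "(\<lambda>x. g \<otimes> x \<otimes> inv g) ` N = N"
    proof
      show "(\<lambda>x. g \<otimes> x \<otimes> inv g) ` N \<subseteq> N" using r by blast
      show "N \<subseteq> (\<lambda>x. g \<otimes> x \<otimes> inv g) ` N"
      proof
        fix x assume x: "x \<in> N"
        then have xG: "x \<in> carrier G" using NG by blast
        show "x \<in> (\<lambda>x. g \<otimes> x \<otimes> inv g) ` N"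
          by (rule image_eqI[where x = "inv g \<otimes> x \<otimes> g"])
            (use conj_inv_cancel(1)[OF g xG] r x in simp_all)
      qed
    qed
  qed
  then show ?thesis
    unfolding normalizer_def stabilizer_def using NG eq by auto
qed

end

context fo_group
begin

lemma definable_normalizer:
  assumes "subgroup N G" "definable G N"
  shows "definable G (normalizer G N)"
proof -
  \<comment> \<open>The updated assignments are written out to match the closure rule for the
    universal quantifier; variable 2 is the fresh one for membership of terms.\<close>
  have "definable_pred G (\<lambda>e. \<forall>x\<in>carrier G. (e(1 := x)) 1 \<in> N \<longrightarrow>
     (e(1 := x)) 0 \<otimes> (e(1 := x)) 1 \<otimes> inv ((e(1 := x)) 0) \<in> N \<and>
     inv ((e(1 := x)) 0) \<otimes> (e(1 := x)) 1 \<otimes> (e(1 := x)) 0 \<in> N)"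
    by (rule definable_pred_all)
      (intro definable_pred_imp definable_pred_and definable_pred_var assms(2)
         definable_pred_mem[where v = 2] definable_fun_mult definable_fun_inv definable_fun_var
         monoid_axioms; simp)
  then have "definable_pred G (\<lambda>e. \<forall>x\<in>carrier G. x \<in> N \<longrightarrow>
     e 0 \<otimes> x \<otimes> inv (e 0) \<in> N \<and> inv (e 0) \<otimes> x \<otimes> e 0 \<in> N)"
    by simp
  then have "definable G {g \<in> carrier G. \<forall>x\<in>carrier G. x \<in> N \<longrightarrow>
     g \<otimes> x \<otimes> inv g \<in> N \<and> inv g \<otimes> x \<otimes> g \<in> N}"
    by (rule definableI) (rule monoid_axioms)
  moreover have "normalizer G N = {g \<in> carrier G. \<forall>x\<in>carrier G. x \<in> N \<longrightarrow>
     g \<otimes> x \<otimes> inv g \<in> N \<and> inv g \<otimes> x \<otimes> g \<in> N}"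
    using mem_normalizer_iff[OF assms(1)] subgroup.mem_carrier[OF assms(1)] by blast
  ultimately show ?thesis by simp
qed

lemma definable_bounded_index:
  assumes "definable G K" "definable G N" "definable G B" "K \<subseteq> carrier G" "B \<subseteq> carrier G"
  shows "definable G {x \<in> K. \<exists>y. range y \<subseteq> carrier G \<and> (\<forall>z\<in>B. \<exists>i\<in>{..<m::nat}. y i \<in> K \<and>
        (z \<otimes> inv (y i)) \<otimes> x \<otimes> inv (z \<otimes> inv (y i)) \<otimes> inv x \<in> N)}"
proof -
  define f where "f = (\<lambda>z y x. (z \<otimes> inv y) \<otimes> x \<otimes> inv (z \<otimes> inv y) \<otimes> inv x)"
  \<comment> \<open>Variable 0 stands for \<open>x\<close>, variable 1 for \<open>z\<close>, and the
    variables from 3 on for the representatives; variable 2 is left free for membership of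
    terms.\<close>
  define P where "P = (\<lambda>e. \<forall>a\<in>carrier G. (e(1 := a)) 1 \<in> B \<longrightarrow> (\<exists>i\<in>{..<m}. (e(1 := a)) (3 + i) \<in> K \<and>
     f ((e(1 := a)) 1) ((e(1 := a)) (3 + i)) ((e(1 := a)) 0) \<in> N))"
  have "definable_pred G (\<lambda>e. f (e 1) (e (3 + i)) (e 0) \<in> N)" for i
  proof (rule definable_pred_mem[where v = 2, OF assms(2) _ monoid_axioms])
    show "definable_fun G (\<lambda>e. f (e 1) (e (3 + i)) (e 0))"
      unfolding f_def
      by (intro definable_fun_mult definable_fun_inv definable_fun_var monoid_axioms)
  qed (simp_all add: f_def)
  then have "definable_pred G P"
    unfolding P_def
    by (intro definable_pred_all definable_pred_imp definable_pred_bex definable_pred_and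
        definable_pred_var assms monoid_axioms finite_lessThan)
  then have ex: "definable_pred G (\<lambda>e. \<exists>y. range y \<subseteq> carrier G \<and>
      P (\<lambda>v. if 3 \<le> v \<and> v < 3 + m then y v else e v))"
    by (rule definable_pred_ex_tuple)
  have "definable_pred G (\<lambda>e. \<exists>y. range y \<subseteq> carrier G \<and>
      (\<forall>z\<in>B. \<exists>i\<in>{..<m}. y i \<in> K \<and> f z (y i) (e 0) \<in> N))"
  proof (rule definable_pred_cong[OF ex])
    fix e :: "nat \<Rightarrow> 'a"
    have P: "P (\<lambda>v. if 3 \<le> v \<and> v < 3 + m then y v else e v) \<longleftrightarrow>
      (\<forall>z\<in>B. \<exists>i\<in>{..<m}. y (3 + i) \<in> K \<and> f z (y (3 + i)) (e 0) \<in> N)" for y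
      unfolding P_def using assms(5) by auto
    show "(\<exists>y. range y \<subseteq> carrier G \<and> P (\<lambda>v. if 3 \<le> v \<and> v < 3 + m then y v else e v)) \<longleftrightarrow>
      (\<exists>y. range y \<subseteq> carrier G \<and> (\<forall>z\<in>B. \<exists>i\<in>{..<m}. y i \<in> K \<and> f z (y i) (e 0) \<in> N))"
      unfolding P
    proof
      assume "\<exists>y. range y \<subseteq> carrier G \<and>
        (\<forall>z\<in>B. \<exists>i\<in>{..<m}. y (3 + i) \<in> K \<and> f z (y (3 + i)) (e 0) \<in> N)"
      then obtain y where y: "range y \<subseteq> carrier G"
        "\<forall>z\<in>B. \<exists>i\<in>{..<m}. y (3 + i) \<in> K \<and> f z (y (3 + i)) (e 0) \<in> N"
        by (elim exE conjE) (rule that)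
      have "range (\<lambda>i. y (3 + i)) \<subseteq> carrier G" using y(1) by auto
      then show "\<exists>y. range y \<subseteq> carrier G \<and> (\<forall>z\<in>B. \<exists>i\<in>{..<m}. y i \<in> K \<and> f z (y i) (e 0) \<in> N)"
        using y(2) by (intro exI[of _ "\<lambda>i. y (3 + i)"] conjI)
    next
      assume "\<exists>y. range y \<subseteq> carrier G \<and> (\<forall>z\<in>B. \<exists>i\<in>{..<m}. y i \<in> K \<and> f z (y i) (e 0) \<in> N)"
      then obtain y where y: "range y \<subseteq> carrier G"
        "\<forall>z\<in>B. \<exists>i\<in>{..<m}. y i \<in> K \<and> f z (y i) (e 0) \<in> N"
        by (elim exE conjE) (rule that)
      have "range (\<lambda>v. y (v - 3)) \<subseteq> carrier G" using y(1) by auto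
      then show "\<exists>y. range y \<subseteq> carrier G \<and>
        (\<forall>z\<in>B. \<exists>i\<in>{..<m}. y (3 + i) \<in> K \<and> f z (y (3 + i)) (e 0) \<in> N)"
        using y(2) by (intro exI[of _ "\<lambda>v. y (v - 3)"] conjI) simp_all
    qed
  qed
  then have "definable_pred G (\<lambda>e. e 0 \<in> K \<and> (\<exists>y. range y \<subseteq> carrier G \<and>
      (\<forall>z\<in>B. \<exists>i\<in>{..<m}. y i \<in> K \<and> f z (y i) (e 0) \<in> N)))"
    by (intro definable_pred_and definable_pred_var assms)
  then have "definable G {x \<in> carrier G. x \<in> K \<and> (\<exists>y. range y \<subseteq> carrier G \<and>
      (\<forall>z\<in>B. \<exists>i\<in>{..<m}. y i \<in> K \<and> f z (y i) x \<in> N))}"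
    by (rule definableI) (rule monoid_axioms)
  moreover have "{x \<in> carrier G. x \<in> K \<and> (\<exists>y. range y \<subseteq> carrier G \<and>
      (\<forall>z\<in>B. \<exists>i\<in>{..<m}. y i \<in> K \<and> f z (y i) x \<in> N))} = {x \<in> K. \<exists>y. range y \<subseteq> carrier G \<and>
      (\<forall>z\<in>B. \<exists>i\<in>{..<m}. y i \<in> K \<and> f z (y i) x \<in> N)}"
    using assms(4) by blast
  ultimately show ?thesis unfolding f_def by simp
qed

lemma definable_commuting_finite:
  assumes "definable G K" "definable G N" "finite S" "S \<subseteq> carrier G" "K \<subseteq> carrier G"
  shows "definable G {x \<in> K. \<forall>g\<in>S. x \<otimes> g \<otimes> inv x \<otimes> inv g \<in> N}"
proof -
  have "definable_pred G (\<lambda>e. e 0 \<otimes> g \<otimes> inv (e 0) \<otimes> inv g \<in> N)" if "g \<in> S" for g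
  proof (rule definable_pred_mem[where v = 1, OF assms(2) _ monoid_axioms])
    \<comment> \<open>The elements of \<open>S\<close> enter the formula as parameters.\<close>
    have g: "g \<in> carrier G" "inv g \<in> carrier G" using that assms(4) by auto
    show "definable_fun G (\<lambda>e. e 0 \<otimes> g \<otimes> inv (e 0) \<otimes> inv g)"
      by (intro definable_fun_mult definable_fun_inv definable_fun_var definable_fun_const g monoid_axioms)
    show "e 0 \<otimes> g \<otimes> inv (e 0) \<otimes> inv g \<in> carrier G" if "\<And>v. e v \<in> carrier G" for e :: "nat \<Rightarrow> 'a"
      using that g by simp
  qed simp
  then have "definable_pred G (\<lambda>e. e 0 \<in> K \<and> (\<forall>g\<in>S. e 0 \<otimes> g \<otimes> inv (e 0) \<otimes> inv g \<in> N))"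
    by (intro definable_pred_and definable_pred_var definable_pred_ball assms monoid_axioms)
  then have "definable G {x \<in> carrier G. x \<in> K \<and> (\<forall>g\<in>S. x \<otimes> g \<otimes> inv x \<otimes> inv g \<in> N)}"
    by (rule definableI) (rule monoid_axioms)
  moreover have "{x \<in> carrier G. x \<in> K \<and> (\<forall>g\<in>S. x \<otimes> g \<otimes> inv x \<otimes> inv g \<in> N)} =
      {x \<in> K. \<forall>g\<in>S. x \<otimes> g \<otimes> inv x \<otimes> inv g \<in> N}" using assms(5) by blast
  ultimately show ?thesis by simp
qed

lemma definable_commuting_commutators:
  assumes "definable G B" "definable G N" "B \<subseteq> carrier G"
  shows "definable G {x \<in> B. \<forall>y\<in>B. \<forall>z\<in>B.
      x \<otimes> (y \<otimes> z \<otimes> inv y \<otimes> inv z) \<otimes> inv x \<otimes> inv (y \<otimes> z \<otimes> inv y \<otimes> inv z) \<in> N}"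
proof -
  define f where "f = (\<lambda>x y z.
    x \<otimes> (y \<otimes> z \<otimes> inv y \<otimes> inv z) \<otimes> inv x \<otimes> inv (y \<otimes> z \<otimes> inv y \<otimes> inv z))"
  have "definable_pred G (\<lambda>e. f (e 0) (e 1) (e 2) \<in> N)"
  proof (rule definable_pred_mem[where v = 3, OF assms(2) _ monoid_axioms])
    show "definable_fun G (\<lambda>e. f (e 0) (e 1) (e 2))"
      unfolding f_def
      by (intro definable_fun_mult definable_fun_inv definable_fun_var monoid_axioms)
  qed (simp_all add: f_def)
  then have "definable_pred G (\<lambda>e. e 1 \<in> B \<longrightarrow> e 2 \<in> B \<longrightarrow> f (e 0) (e 1) (e 2) \<in> N)"
    by (intro definable_pred_imp definable_pred_var assms)
  then have "definable_pred G (\<lambda>e. \<forall>y\<in>carrier G. \<forall>z\<in>carrier G. (e(1 := y, 2 := z)) 1 \<in> B \<longrightarrow>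
      (e(1 := y, 2 := z)) 2 \<in> B \<longrightarrow>
      f ((e(1 := y, 2 := z)) 0) ((e(1 := y, 2 := z)) 1) ((e(1 := y, 2 := z)) 2) \<in> N)"
    using definable_pred_all[OF definable_pred_all, of G "\<lambda>e. e 1 \<in> B \<longrightarrow> e 2 \<in> B \<longrightarrow> f (e 0) (e 1) (e 2) \<in> N" 1 2]
    by blast
  then have "definable_pred G (\<lambda>e. \<forall>y\<in>carrier G. \<forall>z\<in>carrier G. y \<in> B \<longrightarrow> z \<in> B \<longrightarrow> f (e 0) y z \<in> N)"
    by simp
  then have "definable_pred G (\<lambda>e. e 0 \<in> B \<and>
      (\<forall>y\<in>carrier G. \<forall>z\<in>carrier G. y \<in> B \<longrightarrow> z \<in> B \<longrightarrow> f (e 0) y z \<in> N))"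
    by (intro definable_pred_and definable_pred_var assms)
  then have "definable G {x \<in> carrier G. x \<in> B \<and>
      (\<forall>y\<in>carrier G. \<forall>z\<in>carrier G. y \<in> B \<longrightarrow> z \<in> B \<longrightarrow> f x y z \<in> N)}"
    by (rule definableI) (rule monoid_axioms)
  moreover have "{x \<in> carrier G. x \<in> B \<and>
      (\<forall>y\<in>carrier G. \<forall>z\<in>carrier G. y \<in> B \<longrightarrow> z \<in> B \<longrightarrow> f x y z \<in> N)} =
      {x \<in> B. \<forall>y\<in>B. \<forall>z\<in>B. f x y z \<in> N}" using assms(3) by blast
  ultimately show ?thesis unfolding f_def by simp
qed

text \<open>One step of the construction: the envelope lemma is applied in the normalizer of
  \<open>N\<close> modulo \<open>N\<close>, and the result is pulled back. The hypothesis
  \<open>ab\<close> says that the image of \<open>A\<close> in this quotient is almost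
  abelian.\<close>

lemma definable_envelope_modulo:
  assumes Mc: "Mc_tilde G"
    and N: "subgroup N G" "definable G N"
    and H: "subgroup H G" "\<And>h x. h \<in> H \<Longrightarrow> x \<in> N \<Longrightarrow> h \<otimes> x \<otimes> inv h \<in> N"
    and A: "subgroup A G" "A \<subseteq> H" "\<And>h a. h \<in> H \<Longrightarrow> a \<in> A \<Longrightarrow> h \<otimes> a \<otimes> inv h \<in> A"
    and ab: "\<And>a. a \<in> A \<Longrightarrow> almost_contained G A {b \<in> A. b \<otimes> a \<otimes> inv b \<otimes> inv a \<in> N}"
  obtains D where "subgroup D G" "definable G D" "derived G (derived G D) \<subseteq> N"
    "almost_contained G A D" "\<And>h x. h \<in> H \<Longrightarrow> x \<in> D \<Longrightarrow> h \<otimes> x \<otimes> inv h \<in> D"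
proof -
  define K where "K = normalizer G N"
  have NG: "N \<subseteq> carrier G" using N(1) by (simp add: subgroup.subset)
  have "subquotient G K N"
    unfolding K_def subquotient_def subquotient_axioms_def
    using normalizer_imp_subgroup[OF NG] subgroup_in_normalizer[OF N(1)] is_group by blast
  then interpret subquotient G K N .
  have KG: "K \<subseteq> carrier G" using K_closed by blast
  have defK: "definable G K" unfolding K_def by (rule definable_normalizer[OF N])
  have HK: "H \<subseteq> K"
  proof
    fix h assume h: "h \<in> H"
    have "inv h \<in> H" "h \<in> carrier G" using h H(1) by (auto simp: subgroup_def)
    then show "h \<in> K"
      unfolding K_def mem_normalizer_iff[OF N(1)] using h H(2)[of h] H(2)[of "inv h"] by simp
  qed
  have AK: "A \<subseteq> K" using A(2) HK by blast
  obtain d where d: "Q.almost_minimal_centralizers d"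
    using almost_minimal_centralizers_of_Mc_tilde[OF Mc \<open>subquotient G K N\<close> defK N(2)] K_def by blast
  define A' where "A' = (\<lambda>x. N #> x) ` A"
  define H' where "H' = (\<lambda>x. N #> x) ` H"
  have A': "subgroup A' Q" unfolding A'_def by (rule subgroup_proj_image[OF A(1) AK])
  have H': "subgroup H' Q" unfolding H'_def by (rule subgroup_proj_image[OF H(1) HK])
  have ab': "almost_contained Q A' (centralizer Q {a})" if a: "a \<in> A'" for a
  proof -
    obtain x where x: "x \<in> A" "a = N #> x" using a unfolding A'_def by blast
    have xK: "x \<in> K" using x AK by blast
    obtain T where T: "T \<subseteq> carrier G" "finite T"
      "\<And>b. b \<in> A \<Longrightarrow> \<exists>t\<in>T. b \<otimes> inv t \<in> {b \<in> A. b \<otimes> x \<otimes> inv b \<otimes> inv x \<in> N}"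
      by (rule almost_containedE[OF ab[OF x(1)]]) blast
    have "\<exists>t\<in>T \<inter> K. N #> (b \<otimes> inv t) \<in> centralizer Q {a}" if b: "b \<in> A" for b
    proof -
      obtain t where t: "t \<in> T" "b \<otimes> inv t \<in> A"
        "(b \<otimes> inv t) \<otimes> x \<otimes> inv (b \<otimes> inv t) \<otimes> inv x \<in> N" using T(3)[OF b] by blast
      have G: "b \<in> carrier G" "t \<in> carrier G" using b AK KG t(1) T(1) by auto
      \<comment> \<open>The representative \<open>t\<close> is given only in \<open>G\<close>, but
        it is a quotient of two elements of \<open>K\<close> and so has a coset in
        \<open>Q\<close>.\<close>
      have "inv (b \<otimes> inv t) \<otimes> b \<in> K" using b t(2) AK K_closed by blast
      then have "t \<in> K" using G by (simp add: inv_mult_group m_assoc)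
      moreover have "N #> (b \<otimes> inv t) \<in> centralizer Q {a}"
        unfolding x(2) using proj_mem_centralizer_iff[of "b \<otimes> inv t" x] t AK xK by blast
      ultimately show ?thesis using t(1) by blast
    qed
    then have "\<exists>T \<subseteq> K. finite T \<and> (\<forall>b\<in>A. \<exists>t\<in>T. N #> (b \<otimes> inv t) \<in> centralizer Q {a})"
      using T(2) by (intro exI[of _ "T \<inter> K"]) auto
    moreover have "centralizer Q {a} \<subseteq> carrier Q" unfolding centralizer_def by blast
    ultimately show ?thesis unfolding A'_def using almost_contained_proj_iff[OF AK] by blast
  qed
  have conj: "(N #> h) \<otimes>\<^bsub>Q\<^esub> (N #> x) \<otimes>\<^bsub>Q\<^esub> inv\<^bsub>Q\<^esub> (N #> h) = N #> (h \<otimes> x \<otimes> inv h)"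
    if "h \<in> K" "x \<in> K" for h x
    using that K_closed by (simp add: proj_mult proj_inv del: mult_FactGroup)
  have HA': "h \<otimes>\<^bsub>Q\<^esub> a \<otimes>\<^bsub>Q\<^esub> inv\<^bsub>Q\<^esub> h \<in> A'" if ha: "h \<in> H'" "a \<in> A'" for h a
  proof -
    obtain g x where gx: "g \<in> H" "h = N #> g" "x \<in> A" "a = N #> x"
      using ha unfolding H'_def A'_def by blast
    have "h \<otimes>\<^bsub>Q\<^esub> a \<otimes>\<^bsub>Q\<^esub> inv\<^bsub>Q\<^esub> h = N #> (g \<otimes> x \<otimes> inv g)"
      unfolding gx(2,4) using gx(1,3) HK AK by (intro conj) auto
    then show ?thesis unfolding A'_def using A(3)[OF gx(1,3)] by blast
  qed
  obtain S E F M F' M' D where env: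
    "finite S" "S \<subseteq> carrier Q" "E = centralizer Q S"
    "F = {x \<in> carrier Q. index_le Q E (centralizer Q {x}) M}"
    "F' = {x \<in> F. index_le Q F (centralizer Q {x}) M'}"
    "D = Q.commutator_centralizer F'"
    "subgroup F Q" "subgroup F' Q" "almost_contained Q A' D"
    "\<And>h x. h \<in> H' \<Longrightarrow> x \<in> D \<Longrightarrow> h \<otimes>\<^bsub>Q\<^esub> x \<otimes>\<^bsub>Q\<^esub> inv\<^bsub>Q\<^esub> h \<in> D"
    by (rule Q.almost_abelian_envelope[OF d A' ab' H' HA']) blast+
  let ?pre = "\<lambda>B. {x \<in> K. N #> x \<in> B}"
  have pre: "?pre B \<subseteq> carrier G" for B using KG by blast
  have EQ: "E \<subseteq> carrier Q" unfolding env(3) centralizer_def by blast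
  have FQ: "F \<subseteq> carrier Q" unfolding env(4) by blast
  have F'Q: "F' \<subseteq> carrier Q" using FQ unfolding env(5) by blast
  obtain s where s: "s \<subseteq> K" "finite s" "S = (\<lambda>x. N #> x) ` s"
    using finite_subset_image[OF env(1)] env(2) unfolding carrier_Q by blast
  \<comment> \<open>The preimages are defined one after the other: that of \<open>E\<close> from the
    finitely many parameters \<open>s\<close>, those of \<open>F\<close> and \<open>F'\<close> from
    the index bounds, that of \<open>D\<close> from the commutators of the preimage of
    \<open>F'\<close>.\<close>
  have "?pre E = {x \<in> K. \<forall>g\<in>s. x \<otimes> g \<otimes> inv x \<otimes> inv g \<in> N}"
  proof -
    have "N #> x \<in> E \<longleftrightarrow> (\<forall>g\<in>s. N #> x \<in> centralizer Q {N #> g})" if "x \<in> K" for x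
      unfolding env(3) s(3) centralizer_def using proj_closed[OF that] by simp
    then show ?thesis using proj_mem_centralizer_iff s(1) by blast
  qed
  then have defE: "definable G (?pre E)"
    using definable_commuting_finite[OF defK N(2) s(2) _ KG] s(1) KG by simp
  have index: "{x \<in> K. index_le Q B (centralizer Q {N #> x}) m} =
    {x \<in> K. \<exists>y. range y \<subseteq> carrier G \<and> (\<forall>z\<in>?pre B. \<exists>i\<in>{..<m}. y i \<in> K \<and>
        (z \<otimes> inv (y i)) \<otimes> x \<otimes> inv (z \<otimes> inv (y i)) \<otimes> inv x \<in> N)}" if "B \<subseteq> carrier Q" for B m
    using index_le_centralizer_proj_iff[OF _ that] by (intro Collect_cong conj_cong refl) (simp add: Ball_def imp_conjL)
  have def_index: "definable G {x \<in> K. index_le Q B (centralizer Q {N #> x}) m}"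
    if "B \<subseteq> carrier Q" "definable G (?pre B)" for B m
    unfolding index[OF that(1)] by (rule definable_bounded_index[OF defK N(2) that(2) KG pre])
  have "?pre F = {x \<in> K. index_le Q E (centralizer Q {N #> x}) M}"
    unfolding env(4) using proj_closed by blast
  then have defF: "definable G (?pre F)" using def_index[OF EQ defE] by simp
  have "?pre F' = ?pre F \<inter> {x \<in> K. index_le Q F (centralizer Q {N #> x}) M'}"
    unfolding env(5) by blast
  then have defF': "definable G (?pre F')"
    using definable_Int[OF monoid_axioms defF def_index[OF FQ defF] pre] by simp
  have "?pre D = {x \<in> ?pre F'. \<forall>y\<in>?pre F'. \<forall>z\<in>?pre F'.
      x \<otimes> (y \<otimes> z \<otimes> inv y \<otimes> inv z) \<otimes> inv x \<otimes> inv (y \<otimes> z \<otimes> inv y \<otimes> inv z) \<in> N}"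
    unfolding env(6) using proj_mem_commutator_centralizer_iff[OF _ F'Q] by blast
  then have defD: "definable G (?pre D)"
    using definable_commuting_commutators[OF defF' N(2) pre] by simp
  have D: "subgroup D Q" unfolding env(6) by (rule Q.subgroup_commutator_centralizer[OF env(8)])
  have "derived G (derived G (?pre D)) \<subseteq> N"
    unfolding env(6) by (rule derived_derived_subset[OF env(8)])
  moreover have "almost_contained G A (?pre D)"
  proof -
    obtain T where T: "T \<subseteq> K" "finite T" "\<And>a. a \<in> A \<Longrightarrow> \<exists>t\<in>T. N #> (a \<otimes> inv t) \<in> D"
      using env(9) almost_contained_proj_iff[OF AK subgroup.subset[OF D]] unfolding A'_def by metis
    show ?thesis
    proof (rule almost_containedI[OF _ T(2)])
      show "T \<subseteq> carrier G" using T(1) KG by blast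
      fix a assume a: "a \<in> A"
      then obtain t where t: "t \<in> T" "N #> (a \<otimes> inv t) \<in> D" using T(3) by blast
      moreover have "a \<otimes> inv t \<in> K" using a t(1) T(1) AK K_closed by blast
      ultimately show "\<exists>t\<in>T. a \<otimes> inv t \<in> ?pre D" by blast
    qed
  qed
  moreover have "h \<otimes> x \<otimes> inv h \<in> ?pre D" if h: "h \<in> H" and x: "x \<in> ?pre D" for h x
  proof -
    have K: "h \<in> K" "x \<in> K" using h x HK by auto
    have "(N #> h) \<otimes>\<^bsub>Q\<^esub> (N #> x) \<otimes>\<^bsub>Q\<^esub> inv\<^bsub>Q\<^esub> (N #> h) \<in> D"
      using env(10) h x unfolding H'_def by blast
    then have "N #> (h \<otimes> x \<otimes> inv h) \<in> D" using conj[OF K] by metis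
    moreover have "h \<otimes> x \<otimes> inv h \<in> K" using K K_closed by simp
    ultimately show ?thesis by blast
  qed
  ultimately show thesis using that[OF subgroup_proj_vimage[OF D] defD] by blast
qed

end

section \<open>Almost solvable subgroups\<close>

context subquotient
begin

text \<open>On the subgroup of the elements that commute with \<open>a\<close> modulo \<open>N\<close>, the commutator with \<open>a\<close>
  takes its values in \<open>N\<close>, hence only finitely many values modulo \<open>M\<close>.\<close>

lemma almost_contained_commuting_modulo:
  assumes ab: "almost_abelian Q"
    and M: "subgroup M G" "almost_contained G N M"
    and inv_M: "\<And>k x. k \<in> K \<Longrightarrow> x \<in> M \<Longrightarrow> k \<otimes> x \<otimes> inv k \<in> M"
    and a: "a \<in> K"
  shows "almost_contained G K {b \<in> K. b \<otimes> a \<otimes> inv b \<otimes> inv a \<in> M}"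
proof -
  have KG: "K \<subseteq> carrier G" using K_closed by blast
  define C where "C = centralizer Q {N #> a}"
  have aQ: "N #> a \<in> carrier Q" by (rule proj_closed[OF a])
  have C: "subgroup C Q" unfolding C_def using aQ by (intro Q.subgroup_centralizer) simp
  have CQ: "C \<subseteq> carrier Q" by (rule subgroup.subset[OF C])
  have "finite_index Q C" using ab aQ unfolding almost_abelian_def C_def by blast
  then have "finite_index (Q\<lparr>carrier := carrier Q\<rparr>) C" by simp
  then have "index_le Q (carrier Q) C (card (rcosets\<^bsub>Q\<lparr>carrier := carrier Q\<rparr>\<^esub> C))"
    using Q.index_le_of_card_rcosets[OF subset_refl CQ subgroup.one_closed[OF C]] by blast
  then have "almost_contained Q ((\<lambda>x. N #> x) ` K) C"
    unfolding almost_contained_def carrier_Q by blast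
  then obtain T where T: "T \<subseteq> K" "finite T" "\<And>b. b \<in> K \<Longrightarrow> \<exists>t\<in>T. N #> (b \<otimes> inv t) \<in> C"
    using almost_contained_proj_iff[OF subset_refl CQ] by metis
  define C1 where "C1 = {b \<in> K. N #> b \<in> C}"
  have C1: "subgroup C1 G" unfolding C1_def by (rule subgroup_proj_vimage[OF C])
  have KC1: "almost_contained G K C1"
  proof (rule almost_containedI[OF _ T(2)])
    show "T \<subseteq> carrier G" using T(1) KG by blast
    fix b assume b: "b \<in> K"
    obtain t where t: "t \<in> T" "N #> (b \<otimes> inv t) \<in> C" using T(3)[OF b] by blast
    moreover have "b \<otimes> inv t \<in> K" using b t(1) T(1) K_closed by blast
    ultimately show "\<exists>t\<in>T. b \<otimes> inv t \<in> C1" unfolding C1_def by blast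
  qed
  obtain U where U: "U \<subseteq> carrier G" "finite U" "\<And>c. c \<in> N \<Longrightarrow> \<exists>u\<in>U. c \<otimes> inv u \<in> M"
    by (rule almost_containedE[OF M(2)]) blast
  \<comment> \<open>\<open>P u w\<close> says that the commutator of \<open>inv w\<close> with
    \<open>a\<close> lies in the coset of \<open>u\<close> modulo \<open>M\<close>. One such
    \<open>w\<close> for each of the finitely many \<open>u\<close> will represent the
    cosets.\<close>
  define P where "P = (\<lambda>u w. w \<in> C1 \<and> inv w \<otimes> a \<otimes> w \<otimes> inv a \<otimes> inv u \<in> M)"
  define r where "r = (\<lambda>u. if \<exists>w. P u w then SOME w. P u w else \<one>)"
  have r: "P u (r u)" if "P u w" for u w
    unfolding r_def using that someI[of "P u" w] by auto
  have rC: "r u \<in> C1" for u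
    using r[of u] subgroup.one_closed[OF C1] unfolding r_def P_def
    by (cases "\<exists>w. P u w") (auto simp: r_def P_def)
  have C1K: "C1 \<subseteq> K" unfolding C1_def by blast
  have "almost_contained G C1 {b \<in> K. b \<otimes> a \<otimes> inv b \<otimes> inv a \<in> M}"
  proof (rule almost_containedI)
    show "r ` U \<subseteq> carrier G" "finite (r ` U)" using U(2) rC C1K KG by blast+
    fix w assume w: "w \<in> C1"
    have "inv w \<in> C1" by (rule subgroup.m_inv_closed[OF C1 w])
    then have "inv w \<otimes> a \<otimes> inv (inv w) \<otimes> inv a \<in> N"
      using proj_mem_centralizer_iff[of "inv w" a] a unfolding C1_def C_def by blast
    moreover have wK: "w \<in> K" "w \<in> carrier G" using w C1K KG by auto
    ultimately have "inv w \<otimes> a \<otimes> w \<otimes> inv a \<in> N" by simp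
    then obtain u where u: "u \<in> U" "inv w \<otimes> a \<otimes> w \<otimes> inv a \<otimes> inv u \<in> M" using U(3) by blast
    have "P u w" unfolding P_def using w u(2) by blast
    then have ru: "inv (r u) \<otimes> a \<otimes> r u \<otimes> inv a \<otimes> inv u \<in> M" using r unfolding P_def by blast
    define v where "v = r u"
    have vK: "v \<in> K" "v \<in> carrier G" unfolding v_def using rC C1K KG by auto
    have G: "a \<in> carrier G" "u \<in> carrier G" using a KG u(1) U(1) by auto
    have "(inv v \<otimes> a \<otimes> v \<otimes> inv a) \<otimes> inv (inv w \<otimes> a \<otimes> w \<otimes> inv a) \<in> M"
      by (rule subgroup_mult_invD[OF M(1) ru[folded v_def] u(2)]) (use wK vK G in simp_all)
    \<comment> \<open>The commutators belonging to \<open>w\<close> and \<open>v\<close> lie in the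
      same coset of \<open>M\<close>. Conjugating their quotient by \<open>w\<close> gives the
      commutator of \<open>w \<otimes> inv v\<close> with \<open>a\<close>, which stays in
      \<open>M\<close> by invariance.\<close>
    then have "w \<otimes> ((inv v \<otimes> a \<otimes> v \<otimes> inv a) \<otimes> inv (inv w \<otimes> a \<otimes> w \<otimes> inv a)) \<otimes> inv w \<in> M"
      by (rule inv_M[OF wK(1)])
    also have "w \<otimes> ((inv v \<otimes> a \<otimes> v \<otimes> inv a) \<otimes> inv (inv w \<otimes> a \<otimes> w \<otimes> inv a)) \<otimes> inv w =
        (w \<otimes> inv v) \<otimes> a \<otimes> inv (w \<otimes> inv v) \<otimes> inv a"
      using wK(2) vK(2) G by (simp add: inv_mult_group m_assoc)
    finally have "(w \<otimes> inv v) \<otimes> a \<otimes> inv (w \<otimes> inv v) \<otimes> inv a \<in> M" .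
    moreover have "w \<otimes> inv v \<in> K" using wK(1) vK(1) K_closed by blast
    ultimately show "\<exists>t\<in>r ` U. w \<otimes> inv t \<in> {b \<in> K. b \<otimes> a \<otimes> inv b \<otimes> inv a \<in> M}"
      using u(1) unfolding v_def by blast
  qed
  then show ?thesis using almost_contained_trans[OF KC1] KG by blast
qed

end

section \<open>Derived length and induction along the series\<close>

context group
begin

lemma derived_pow_consistent:
  assumes "subgroup D G"
  shows "(derived (G\<lparr>carrier := D\<rparr>) ^^ m) D = (derived G ^^ m) D"
proof (induction m)
  case (Suc m)
  have "(derived G ^^ m) D \<subseteq> D"
    by (induction m) (use derived_incl[OF _ assms] in auto)
  then show ?case using Suc derived_consistent[OF _ assms] by simp
qed simp

lemma solvable_subgroup_of_derived_pow:
  assumes "subgroup D G" "(derived G ^^ m) D = {\<one>}"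
  shows "solvable (G\<lparr>carrier := D\<rparr>)" "solvable_class (G\<lparr>carrier := D\<rparr>) \<le> m"
proof -
  have eq: "(derived (G\<lparr>carrier := D\<rparr>) ^^ m) (carrier (G\<lparr>carrier := D\<rparr>)) = {\<one>\<^bsub>G\<lparr>carrier := D\<rparr>\<^esub>}"
    using derived_pow_consistent[OF assms(1)] assms(2) by simp
  then show "solvable (G\<lparr>carrier := D\<rparr>)"
    using group.solvable_iff_trivial_derived_seq[OF subgroup_imp_group[OF assms(1)]] by blast
  show "solvable_class (G\<lparr>carrier := D\<rparr>) \<le> m"
    unfolding solvable_class_def by (rule Least_le) (rule eq)
qed

end

text \<open>The index \<open>k\<close> counts the factors treated so far from the bottom of the
  series. Invariance under \<open>H\<close> is carried along because the next step takes place in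
  the normalizer of the group constructed.\<close>

lemma (in fo_group) definable_envelope_of_series:
  assumes Mc: "Mc_tilde G" and H: "subgroup H G"
    and S: "almost_solvable_series (G\<lparr>carrier := H\<rparr>) n S" and "k \<le> n"
  shows "\<exists>D. subgroup D G \<and> definable G D \<and> (derived G ^^ (2 * k)) D = {\<one>} \<and>
    almost_contained G (S (n - k)) D \<and> (\<forall>h\<in>H. \<forall>x\<in>D. h \<otimes> x \<otimes> inv h \<in> D)"
  using \<open>k \<le> n\<close>
proof (induction k)
  case 0
  have Sn: "S (n - 0) = {\<one>}" using S unfolding almost_solvable_series_def by simp
  have "definable G {x \<in> carrier G. x = \<one>}"
    by (rule definableI)
      (intro definable_pred_eq definable_fun_var definable_fun_const one_closed monoid_axioms)+
  moreover have "{x \<in> carrier G. x = \<one>} = {\<one>}" by auto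
  ultimately have "definable G {\<one>}" by simp
  moreover have "subgroup {\<one>} G" by (rule triv_subgroup)
  moreover have "\<forall>h\<in>H. \<forall>x\<in>{\<one>}. h \<otimes> x \<otimes> inv h \<in> {\<one>}" using subgroup.mem_carrier[OF H] by simp
  ultimately show ?case
    unfolding Sn using almost_contained_subset[of "{\<one>}" "{\<one>}"] by (intro exI[of _ "{\<one>}"]) simp
next
  case (Suc k)
  define A where "A = S (n - Suc k)"
  define B where "B = S (n - k)"
  have Suc_eq: "Suc (n - Suc k) = n - k" using Suc.prems by simp
  have normal: "S i \<lhd> G\<lparr>carrier := H\<rparr>" if "i \<le> n" for i
    using S that unfolding almost_solvable_series_def by blast
  have AH: "A \<lhd> G\<lparr>carrier := H\<rparr>" and BH: "B \<lhd> G\<lparr>carrier := H\<rparr>"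
    unfolding A_def B_def by (intro normal; simp)+
  have BA: "B \<subseteq> A" and ab: "almost_abelian ((G\<lparr>carrier := A\<rparr>) Mod B)"
    using S Suc.prems Suc_eq unfolding almost_solvable_series_def A_def B_def
    by (auto dest!: spec[of _ "n - Suc k"])
  have sub: "subgroup A G" "A \<subseteq> H" "subgroup B (G\<lparr>carrier := A\<rparr>)"
  proof -
    have A: "subgroup A (G\<lparr>carrier := H\<rparr>)" and B: "subgroup B (G\<lparr>carrier := H\<rparr>)"
      using AH BH by (simp_all add: normal_imp_subgroup)
    show "subgroup A G" using incl_subgroup[OF H A] .
    show "A \<subseteq> H" using subgroup.subset[OF A] by simp
    show "subgroup B (G\<lparr>carrier := A\<rparr>)"
      using subgroup_incl[OF incl_subgroup[OF H B] \<open>subgroup A G\<close> BA] .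
  qed
  have conj: "h \<otimes> x \<otimes> inv h \<in> L" if "L \<lhd> G\<lparr>carrier := H\<rparr>" "h \<in> H" "x \<in> L" for L h x
    using normal.inv_op_closed2[OF that(1), of h x] that(2,3) m_inv_consistent[OF H that(2)] by simp
  have "B \<lhd> G\<lparr>carrier := A\<rparr>"
    using group.normal_inv_iff[OF subgroup_imp_group[OF sub(1)], of B] sub(3)
      conj[OF BH] sub(2) m_inv_consistent[OF sub(1)] by auto
  then have "subquotient G A B"
    unfolding subquotient_def subquotient_axioms_def using sub(1) is_group by blast
  then interpret s: subquotient G A B .
  obtain N where N: "subgroup N G" "definable G N" "(derived G ^^ (2 * k)) N = {\<one>}"
    "almost_contained G B N" "\<And>h x. h \<in> H \<Longrightarrow> x \<in> N \<Longrightarrow> h \<otimes> x \<otimes> inv h \<in> N"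
    using Suc.IH Suc.prems unfolding B_def by auto
  \<comment> \<open>The induction hypothesis covers \<open>B\<close> only up to finite index by
    \<open>N\<close>, so almost commutation modulo \<open>B\<close> has to be converted into almost
    commutation modulo \<open>N\<close>.\<close>
  have comm: "almost_contained G A {b \<in> A. b \<otimes> a \<otimes> inv b \<otimes> inv a \<in> N}" if "a \<in> A" for a
    by (rule s.almost_contained_commuting_modulo[OF ab N(1,4) _ that]) (use N(5) sub(2) in blast)
  obtain D where D: "subgroup D G" "definable G D" "derived G (derived G D) \<subseteq> N"
    "almost_contained G A D" "\<And>h x. h \<in> H \<Longrightarrow> x \<in> D \<Longrightarrow> h \<otimes> x \<otimes> inv h \<in> D"
    by (rule definable_envelope_modulo[OF Mc N(1,2) H N(5) sub(1,2) conj[OF AH] comm]) blast+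
  \<comment> \<open>Two derivations lead from \<open>D\<close> into \<open>N\<close>; the remaining
    \<open>2 * k\<close> make \<open>N\<close> trivial.\<close>
  have "(derived G ^^ (2 * Suc k)) D = (derived G ^^ (2 * k)) (derived G (derived G D))"
    by (simp add: funpow_swap1)
  also have "\<dots> \<subseteq> {\<one>}" using mono_exp_of_derived[OF D(3), of "2 * k"] N(3) by simp
  finally have "(derived G ^^ (2 * Suc k)) D = {\<one>}"
    using subgroup.one_closed[OF exp_of_derived_is_subgroup[OF D(1), of "2 * Suc k"]] by blast
  then show ?case using D unfolding A_def by blast
qed

theorem theorem3p23:
  fixes G :: "('a, 'f, 'r) group_structure" and H :: "'a set" and n :: nat
  assumes "fo_group G"
    and "Mc_tilde G"
    and "subgroup H G"
    and "almost_solvable (G\<lparr>carrier := H\<rparr>)"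
    and "almost_solvable_class (G\<lparr>carrier := H\<rparr>) = n"
  shows "\<exists>D. subgroup D G \<and> definable G D \<and>
           solvable (G\<lparr>carrier := D\<rparr>) \<and> solvable_class (G\<lparr>carrier := D\<rparr>) \<le> 2 * n \<and>
           finite_index (G\<lparr>carrier := H\<rparr>) (H \<inter> D)"
proof -
  interpret fo_group G by (rule assms(1))
  \<comment> \<open>The class is a least number over a nonempty set, hence it is attained by a
    series of exactly this length.\<close>
  have "\<exists>S. almost_solvable_series (G\<lparr>carrier := H\<rparr>) n S"
    using assms(4) LeastI_ex[of "\<lambda>n. \<exists>S. almost_solvable_series (G\<lparr>carrier := H\<rparr>) n S"]
    unfolding almost_solvable_def assms(5)[symmetric] almost_solvable_class_def by blast
  then obtain S where S: "almost_solvable_series (G\<lparr>carrier := H\<rparr>) n S" by blast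
  obtain D where D: "subgroup D G" "definable G D" "(derived G ^^ (2 * n)) D = {\<one>\<^bsub>G\<^esub>}"
    "almost_contained G (S (n - n)) D"
    using definable_envelope_of_series[OF assms(2,3) S le_refl] by blast
  have "S (n - n) = H" using S unfolding almost_solvable_series_def by simp
  then have "finite_index (G\<lparr>carrier := H\<rparr>) (H \<inter> D)"
    using finite_index_of_almost_contained[OF _ assms(3) D(1)] D(4) by simp
  then show ?thesis using D(1,2) solvable_subgroup_of_derived_pow[OF D(1,3)] by blast
qed

end
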